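(* Let $G$ be a compact abelian group and let $\Phi$ be an $N$-function. Consider $A_\Phi(G)$ as a Banach algebra with the convolution product. Then the character space $\Delta(A_\Phi(G))$ is homeomorphic to $\widehat G$, the dual group of $G$.
   Context: $G$ carries a fixed Haar measure $\lambda$; measurable functions equal $\lambda$-a.e. are identified. $N$-functions. An $N$-function is a convex even function $\Phi:\mathbb R\to[0,\infty)$ with $\Phi(x)=0$ if and only if $x=0$, $\lim_{x\to0}\Phi(x)/x=0$ and $\lim_{x\to\infty}\Phi(x)/x=\infty$. Its complementary $N$-function is $\Psi(y)=\sup\{x|y|-\Phi(x):x\ge0\}$. Orlicz spaces. For measurable $f:G\to\mathbb C$ put $\rho_\Phi(f)=\int_G\Phi(|f(x)|)\,d\lambda(x)$. Let $M^\Phi(G)=\{f:\rho_\Phi(af)<\infty\text{ for all }a>0\}$ (and similarly $M^\Psi(G)$), $N_\Phi(f)=\inf\{k>0:\rho_\Phi(f/k)\le1\}$, and $\|g\|_\Psi=\sup\{\int_G|fg|\,d\lambda: f\text{ measurable},\ N_\Phi(f)\le1\}$. Convolution: $(f*g)(x)=\int_G f(y)g(y^{-1}x)\,d\lambda(y)$. Write $\check g(x)=g(x^{-1})$. The space $A_\Phi(G)$. It consists of all $u\in C_0(G)$ for which there are sequences $(f_n)\subseteq M^\Phi(G)$, $(g_n)\subseteq M^\Psi(G)$ with $\sum_{n=1}^\infty N_\Phi(f_n)\|g_n\|_\Psi<\infty$ and $u=\sum_{n=1}^\infty f_n*\check g_n$. It is a Banach space under the norm $\|u\|_{A_\Phi}=\inf\sum_{n=1}^\infty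 N_\Phi(f_n)\|g_n\|_\Psi$, the infimum being over all such representations of $u$. For compact $G$, $A_\Phi(G)$ is closed under convolution and is a Banach algebra in the sense that $\|u*v\|_{A_\Phi}\le C\|u\|_{A_\Phi}\|v\|_{A_\Phi}$ for some constant $C>0$. The character space $\Delta(A)$ of a Banach algebra $A$ is the set of all nonzero bounded multiplicative linear functionals on $A$, with the Gelfand (relative weak-$*$) topology. $\widehat G$ is the group of continuous homomorphisms $G\to\mathbb T$ with its usual (compact-open) topology, which is discrete since $G$ is compact. *)

theory Defs
  imports "HOL-Analysis.Analysis"
begin

text \<open>
  Groups are written additively, so that the type class \<^class>\<open>topological_group_add\<close> applies;
  thus \<^term>\<open>- y + x\<close> stands for $y^{-1}x$.
\<close>

section \<open>Haar measure\<close>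

text \<open>
  No second countability is assumed, so regularity has to be required explicitly.
  Invariance is left invariance, and no normalisation is imposed.
\<close>

definition haar_measure :: "'g::{topological_group_add, t2_space} measure \<Rightarrow> bool" where
  "haar_measure M \<longleftrightarrow>
     sets M = sets borel \<and>
     emeasure M UNIV \<noteq> 0 \<and>
     (\<forall>K. compact K \<longrightarrow> emeasure M K < \<infinity>) \<and>
     (\<forall>a. \<forall>B\<in>sets borel. emeasure M ((\<lambda>x. a + x) ` B) = emeasure M B) \<and>
     (\<forall>B\<in>sets borel. emeasure M B = (INF U\<in>{U. open U \<and> B \<subseteq> U}. emeasure M U)) \<and>
     (\<forall>U. open U \<longrightarrow> emeasure M U = (SUP K\<in>{K. compact K \<and> K \<subseteq> U}. emeasure M K))"


section \<open>N-functions and Orlicz spaces\<close>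

definition N_function :: "(real \<Rightarrow> real) \<Rightarrow> bool" where
  "N_function \<Phi> \<longleftrightarrow>
     convex_on UNIV \<Phi> \<and>
     (\<forall>x. \<Phi> (- x) = \<Phi> x) \<and>
     (\<forall>x. 0 \<le> \<Phi> x) \<and>
     (\<forall>x. \<Phi> x = 0 \<longleftrightarrow> x = 0) \<and>
     ((\<lambda>x. \<Phi> x / x) \<longlongrightarrow> 0) (at 0) \<and>
     filterlim (\<lambda>x. \<Phi> x / x) at_top at_top"

definition complementary :: "(real \<Rightarrow> real) \<Rightarrow> real \<Rightarrow> real" where
  "complementary \<Phi> y = (SUP x\<in>{0..}. x * \<bar>y\<bar> - \<Phi> x)"

definition modular :: "'g measure \<Rightarrow> (real \<Rightarrow> real) \<Rightarrow> ('g \<Rightarrow> complex) \<Rightarrow> ennreal" where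
  "modular M \<Phi> f = (\<integral>\<^sup>+ x. ennreal (\<Phi> (cmod (f x))) \<partial>M)"

text \<open>
  The spaces below consist of functions rather than of classes modulo equality almost everywhere;
  all quantities built from them (norms and convolutions) depend only on the classes.
  The two norms are \<^typ>\<open>ennreal\<close>-valued, so that the infimum of the empty set and the supremum
  of an unbounded set are both $\infty$.
\<close>

definition M_space :: "'g measure \<Rightarrow> (real \<Rightarrow> real) \<Rightarrow> ('g \<Rightarrow> complex) set" where
  "M_space M \<Phi> = {f \<in> borel_measurable M. \<forall>a>0. modular M \<Phi> (\<lambda>x. of_real a * f x) < \<infinity>}"

definition luxemburg_norm :: "'g measure \<Rightarrow> (real \<Rightarrow> real) \<Rightarrow> ('g \<Rightarrow> complex) \<Rightarrow> ennreal" where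
  "luxemburg_norm M \<Phi> f =
     (INF k\<in>{k::real. 0 < k \<and> modular M \<Phi> (\<lambda>x. f x / of_real k) \<le> 1}. ennreal k)"

text \<open>
  The Orlicz norm belonging to the function complementary to \<^term>\<open>\<Phi>\<close>, that is, the
  norm $\|g\|_\Psi$ on $M^\Psi$; it is computed from \<^term>\<open>\<Phi>\<close> by duality.
\<close>

definition dual_orlicz_norm :: "'g measure \<Rightarrow> (real \<Rightarrow> real) \<Rightarrow> ('g \<Rightarrow> complex) \<Rightarrow> ennreal" where
  "dual_orlicz_norm M \<Phi> g =
     (SUP f\<in>{f \<in> borel_measurable M. luxemburg_norm M \<Phi> f \<le> 1}.
        \<integral>\<^sup>+ x. ennreal (cmod (f x * g x)) \<partial>M)"


section \<open>The space $A_\Phi(G)$\<close>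

definition convolution ::
  "'g::group_add measure \<Rightarrow> ('g \<Rightarrow> complex) \<Rightarrow> ('g \<Rightarrow> complex) \<Rightarrow> 'g \<Rightarrow> complex" where
  "convolution M f g = (\<lambda>x. \<integral>y. f y * g (- y + x) \<partial>M)"

definition check :: "('g::group_add \<Rightarrow> complex) \<Rightarrow> 'g \<Rightarrow> complex" where
  "check g = (\<lambda>x. g (- x))"

definition C0 :: "('g::topological_space \<Rightarrow> complex) set" where
  "C0 = {u. continuous_on UNIV u \<and> (\<forall>\<epsilon>>0. compact {x. \<epsilon> \<le> cmod (u x)})}"

text \<open>The series representing \<^term>\<open>u\<close> converges in $C_0(G)$, that is, uniformly.\<close>

definition A_representation ::
  "'g::group_add measure \<Rightarrow> (real \<Rightarrow> real) \<Rightarrow> (nat \<Rightarrow> 'g \<Rightarrow> complex) \<Rightarrow> (nat \<Rightarrow> 'g \<Rightarrow> complex)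
     \<Rightarrow> ('g \<Rightarrow> complex) \<Rightarrow> bool" where
  "A_representation M \<Phi> f g u \<longleftrightarrow>
     (\<forall>n. f n \<in> M_space M \<Phi>) \<and>
     (\<forall>n. g n \<in> M_space M (complementary \<Phi>)) \<and>
     (\<Sum>n. luxemburg_norm M \<Phi> (f n) * dual_orlicz_norm M \<Phi> (g n)) < \<infinity> \<and>
     uniform_limit UNIV (\<lambda>N x. \<Sum>n<N. convolution M (f n) (check (g n)) x) u sequentially"

definition A_space ::
  "'g::topological_group_add measure \<Rightarrow> (real \<Rightarrow> real) \<Rightarrow> ('g \<Rightarrow> complex) set" where
  "A_space M \<Phi> = {u \<in> C0. \<exists>f g. A_representation M \<Phi> f g u}"

definition A_norm ::
  "'g::topological_group_add measure \<Rightarrow> (real \<Rightarrow> real) \<Rightarrow> ('g \<Rightarrow> complex) \<Rightarrow> real" where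
  "A_norm M \<Phi> u = enn2real
     (INF (f, g)\<in>{(f, g). A_representation M \<Phi> f g u}.
        \<Sum>n. luxemburg_norm M \<Phi> (f n) * dual_orlicz_norm M \<Phi> (g n))"


section \<open>Character spaces of algebras of functions\<close>

text \<open>
  An algebra of complex functions is given by its carrier \<^term>\<open>A\<close>, its norm \<^term>\<open>nrm\<close> and its
  product \<^term>\<open>prd\<close>; the vector space operations are pointwise. Functionals on \<^term>\<open>A\<close> are
  represented by functions that are \<^const>\<open>undefined\<close> outside \<^term>\<open>A\<close>, so that they are
  determined by their values on \<^term>\<open>A\<close>.
\<close>

definition character_space ::
  "('a \<Rightarrow> complex) set \<Rightarrow> (('a \<Rightarrow> complex) \<Rightarrow> real)
     \<Rightarrow> (('a \<Rightarrow> complex) \<Rightarrow> ('a \<Rightarrow> complex) \<Rightarrow> 'a \<Rightarrow> complex)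
     \<Rightarrow> (('a \<Rightarrow> complex) \<Rightarrow> complex) set" where
  "character_space A nrm prd =
     {\<phi> \<in> extensional A.
        (\<forall>u\<in>A. \<forall>v\<in>A. \<phi> (\<lambda>x. u x + v x) = \<phi> u + \<phi> v) \<and>
        (\<forall>c. \<forall>u\<in>A. \<phi> (\<lambda>x. c * u x) = c * \<phi> u) \<and>
        (\<forall>u\<in>A. \<forall>v\<in>A. \<phi> (prd u v) = \<phi> u * \<phi> v) \<and>
        (\<exists>C. \<forall>u\<in>A. cmod (\<phi> u) \<le> C * nrm u) \<and>
        (\<exists>u\<in>A. \<phi> u \<noteq> 0)}"

text \<open>
  The weak-* topology on functionals is that of pointwise convergence on \<^term>\<open>A\<close>, that is, it is
  induced by the product topology on $\mathbb{C}^A$.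
\<close>

definition gelfand_topology ::
  "('a \<Rightarrow> complex) set \<Rightarrow> (('a \<Rightarrow> complex) \<Rightarrow> real)
     \<Rightarrow> (('a \<Rightarrow> complex) \<Rightarrow> ('a \<Rightarrow> complex) \<Rightarrow> 'a \<Rightarrow> complex)
     \<Rightarrow> (('a \<Rightarrow> complex) \<Rightarrow> complex) topology" where
  "gelfand_topology A nrm prd =
     subtopology (product_topology (\<lambda>_. euclidean) A) (character_space A nrm prd)"


section \<open>The dual group\<close>

definition dual_group :: "('g::topological_group_add \<Rightarrow> complex) set" where
  "dual_group =
     {h. continuous_on UNIV h \<and> (\<forall>x. h x \<in> sphere 0 1) \<and> (\<forall>x y. h (x + y) = h x * h y)}"

definition compact_open_topology ::
  "('a::topological_space \<Rightarrow> 'b::topological_space) topology" where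
  "compact_open_topology =
     topology_generated_by {{h. h ` K \<subseteq> U} | K U. compact K \<and> open U}"

definition dual_group_topology :: "('g::topological_group_add \<Rightarrow> complex) topology" where
  "dual_group_topology = subtopology compact_open_topology dual_group"

end

theory Submission
  imports Defs
begin

text \<open>
  A character $\xi$ of $G$ gives the functional $u \mapsto \int u\,\bar\xi\,d\lambda$ on $A_\Phi(G)$.
  Conversely, let $\phi$ be a character of $A_\Phi(G)$. Continuous functions are dense in
  $M^\Phi(G)$, so $\phi(h * \check g) \neq 0$ for some continuous $h$ and some $g \in M^\Psi(G)$,
  and $F(a) = \phi(a * \check g)$ is a functional on $C(G)$ that is bounded in the supremum norm.
  For $k \in A_\Phi(G)$ associativity gives
  $\phi(k) F(h) = F(k * h) = \int k(y) F(h(y^{-1}\,\cdot\,))\,d\lambda(y)$, and multiplicativity of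
  $\phi$ makes $\theta(y) = F(h(y^{-1}\,\cdot\,)) / F(h)$ a continuous bounded homomorphism; no
  Peter-Weyl theorem is needed. Both topologies are discrete: on the character space because
  $\xi$ itself lies in $A_\Phi(G)$ and orthogonality separates its functional from all others, on the
  dual group because characters at uniform distance less than $1$ coincide.
\<close>

section \<open>Integration on a compact abelian group\<close>

text \<open>Second countability is not assumed, so the product sigma-algebra on G x G may be smaller
  than the Borel one, and Fubini for product measures does not apply directly to f(y) g(y^{-1}x).
  Every interchange of integrals is therefore reduced to kernels continuous in both variables, with
  at most one further factor that is merely integrable. Statements about f in M^\<Phi> are first
  proved for continuous f and then carried over by density. A second obstacle is that the supremum
  norm need not control the norm of A_\<Phi>(G), so \<phi> cannot simply be pulled through a
  uniformly convergent integral. Fixing the second factor g and varying only the first replaces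
  \<phi> by a functional on C(G) for which this is possible. The formula for \<theta> comes from the
  translates u_y of u = h * check g: in a commutative group u_x * u_y = u_{xy} * u_e, and \<phi> of
  this identity is the homomorphism law.\<close>

lemma uniform_slices:
  fixes H :: "'a::topological_space \<Rightarrow> 'b::topological_space \<Rightarrow> complex"
  assumes "compact (UNIV :: 'b set)" "continuous_on UNIV (\<lambda>(y, x). H y x)" "0 < e"
  obtains X where "y0 \<in> X" "open X" "\<And>y x. y \<in> X \<Longrightarrow> cmod (H y x - H y0 x) \<le> e"
proof -
  have c: "continuous_on (UNIV \<times> UNIV) (\<lambda>(y, x). H y x)" using assms(2) by simp
  \<comment> \<open>This is the tube lemma: compactness of the second factor gives one neighbourhood
    of \<open>y0\<close> that works for all \<open>x\<close>.\<close>
  obtain X where "y0 \<in> X" "open X"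
    "\<forall>x\<in>X \<inter> UNIV. \<forall>t\<in>UNIV. dist (case (x, t) of (y, x) \<Rightarrow> H y x) (case (y0, t) of (y, x) \<Rightarrow> H y x) \<le> e"
    by (rule continuous_on_prod_compactE[OF c assms(1) UNIV_I assms(3)])
  then show ?thesis using that[of X] by (auto simp: dist_norm)
qed

text \<open>Turns a finite open cover into a Borel partition: a covered point goes to the index
  inserted last among those \<open>t\<close> with \<open>y \<in> U t\<close>.\<close>

lemma finite_borel_selection:
  fixes U :: "'a::topological_space \<Rightarrow> 'a set"
  assumes "finite T" "\<And>y. open (U y)"
  shows "\<exists>p. finite (range p) \<and> (\<forall>i. p -` {i} \<in> sets borel) \<and> (\<forall>y\<in>(\<Union>t\<in>T. U t). y \<in> U (p y))"
  using assms(1)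
proof (induction T rule: finite_induct)
  case empty
  show ?case
  proof (intro exI conjI allI)
    \<comment> \<open>For the empty cover any constant selection will do, as there is no covered
      point to respect.\<close>
    show "(\<lambda>_::'a. undefined::'a) -` {i} \<in> sets borel" for i
      by (cases "i = undefined") auto
  qed auto
next
  case (insert t T)
  then obtain p where p: "finite (range p)" "\<And>i. p -` {i} \<in> sets borel"
    "\<And>y. y \<in> (\<Union>t\<in>T. U t) \<Longrightarrow> y \<in> U (p y)" by blast
  define q where "q = (\<lambda>y. if y \<in> U t then t else p y)"
  have "finite (range q)"
    by (rule finite_subset[of _ "insert t (range p)"]) (auto simp: q_def p(1))
  moreover have "q -` {i} \<in> sets borel" for i
  proof -
    have "q -` {i} = (if t = i then U t else {}) \<union> (p -` {i} - U t)"
      by (auto simp: q_def split: if_splits)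
    then show ?thesis using p(2) assms(2) by auto
  qed
  moreover have "y \<in> U (q y)" if "y \<in> (\<Union>t\<in>insert t T. U t)" for y
    using that p(3) by (auto simp: q_def)
  ultimately show ?case by blast
qed

text \<open>In effect a simple-function approximation of \<open>H\<close> as a map into the
  continuous functions with the supremum norm: on each of finitely many Borel pieces the slice is
  replaced by one at a fixed parameter.\<close>

lemma finite_borel_approx:
  fixes H :: "'a::topological_space \<Rightarrow> 'b::topological_space \<Rightarrow> complex"
  assumes "compact (UNIV :: 'a set)" "compact (UNIV :: 'b set)"
    "continuous_on UNIV (\<lambda>(y, x). H y x)" "0 < e"
  obtains p where "finite (range p)" "\<And>i. p -` {i} \<in> sets borel"
    "\<And>y x. cmod (H y x - H (p y) x) \<le> e"
proof -
  have "\<exists>X. y0 \<in> X \<and> open X \<and> (\<forall>y\<in>X. \<forall>x. cmod (H y x - H y0 x) \<le> e)" for y0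
    by (rule uniform_slices[OF assms(2-4), of y0]) blast
  then obtain U where U: "\<And>y. y \<in> U y" "\<And>y. open (U y)"
    "\<And>y0 y x. y \<in> U y0 \<Longrightarrow> cmod (H y x - H y0 x) \<le> e" by metis
  obtain T where T: "finite T" "UNIV \<subseteq> (\<Union>y\<in>T. U y)"
  proof (rule compactE_image[OF assms(1), of UNIV U])
    show "UNIV \<subseteq> \<Union> (U ` UNIV)" using U(1) by blast
  qed (use U(2) in auto)
  obtain p where "finite (range p)" "\<And>i. p -` {i} \<in> sets borel"
    "\<And>y. y \<in> (\<Union>t\<in>T. U t) \<Longrightarrow> y \<in> U (p y)"
    using finite_borel_selection[where U = U, OF T(1) U(2)] by blast
  moreover have "\<And>y. y \<in> (\<Union>t\<in>T. U t)" using T(2) by auto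
  ultimately show ?thesis using that[of p] U(3) by metis
qed

lemma continuous_on_curried:
  assumes "continuous_on UNIV (\<lambda>(y, x). H y x)"
  shows "continuous_on UNIV (H y)" "continuous_on UNIV (\<lambda>y. H y x)"
  using continuous_on_compose2[OF assms continuous_on_Pair[OF continuous_on_const continuous_on_id]]
    continuous_on_compose2[OF assms continuous_on_Pair[OF continuous_on_id continuous_on_const]]
  by auto

section \<open>Haar measure on a compact abelian group\<close>

locale compact_haar =
  fixes M :: "'g::{topological_ab_group_add, t2_space} measure"
  assumes compact_UNIV: "compact (UNIV :: 'g set)" and haar: "haar_measure M"
begin

lemma haar_translation: "B \<in> sets borel \<Longrightarrow> emeasure M ((\<lambda>x. a + x) ` B) = emeasure M B"
  using haar[unfolded haar_measure_def, THEN conjunct2, THEN conjunct2, THEN conjunct2, THEN conjunct1]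
  by simp

lemma haar_outer_regular:
  "B \<in> sets borel \<Longrightarrow> emeasure M B = (INF U\<in>{U. open U \<and> B \<subseteq> U}. emeasure M U)"
  using haar[unfolded haar_measure_def, THEN conjunct2, THEN conjunct2, THEN conjunct2,
      THEN conjunct2, THEN conjunct1]
  by (rule bspec)

lemma sets_M [measurable_cong, simp]: "sets M = sets borel"
  using haar by (simp add: haar_measure_def)

lemma space_M [simp]: "space M = UNIV"
  using sets_eq_imp_space_eq[OF sets_M] by simp

sublocale finite_measure M
proof (rule finite_measureI)
  have "\<forall>K. compact K \<longrightarrow> emeasure M K < \<infinity>" using haar unfolding haar_measure_def by simp
  then have "emeasure M UNIV < \<infinity>" using compact_UNIV by simp
  then show "emeasure M (space M) \<noteq> \<infinity>" by simp
qed

definition vol :: real where "vol = measure M UNIV"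

lemma vol_pos: "0 < vol"
proof -
  have "emeasure M UNIV \<noteq> 0" using haar unfolding haar_measure_def by blast
  then have "vol \<noteq> 0" by (simp add: vol_def emeasure_eq_measure)
  then show ?thesis unfolding vol_def using measure_nonneg[of M UNIV] by linarith
qed

lemma emeasure_UNIV: "emeasure M UNIV = ennreal vol"
  by (simp add: vol_def emeasure_eq_measure)

lemma measurable_continuous:
  fixes f :: "'g \<Rightarrow> 'b::topological_space"
  assumes "continuous_on UNIV f" shows "f \<in> borel_measurable M"
  using borel_measurable_continuous_onI[OF assms] by (simp add: measurable_cong_sets[OF sets_M refl])

lemma measurable_translation [measurable]: "(\<lambda>x. a + x) \<in> measurable M M"
  by (simp add: measurable_cong_sets[OF sets_M sets_M] continuous_on_add continuous_on_const
      borel_measurable_continuous_onI)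

lemma distr_translation: "distr M M (\<lambda>x. a + x) = M"
proof (rule measure_eqI)
  fix B assume "B \<in> sets (distr M M (\<lambda>x. a + x))"
  then have B: "B \<in> sets borel" by simp
  have "(\<lambda>x. a + x) -` B = (\<lambda>x. - a + x) ` B"
  proof (intro equalityI subsetI)
    fix x assume "x \<in> (\<lambda>x. a + x) -` B"
    then show "x \<in> (\<lambda>x. - a + x) ` B" by (intro image_eqI[of _ _ "a + x"]) auto
  qed auto
  then have "emeasure M ((\<lambda>x. a + x) -` B) = emeasure M B"
    using haar_translation[OF B, of "- a"] by (simp only:)
  then show "emeasure (distr M M (\<lambda>x. a + x)) B = emeasure M B"
    using B by (simp add: emeasure_distr)
qed simp

lemma nn_integral_translation:
  assumes "f \<in> borel_measurable M"
  shows "(\<integral>\<^sup>+x. f (a + x) \<partial>M) = (\<integral>\<^sup>+x. f x \<partial>M)"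
  using nn_integral_distr[OF measurable_translation[of a], of f] assms by (simp add: distr_translation)

lemma integral_translation:
  fixes f :: "'g \<Rightarrow> complex"
  assumes "f \<in> borel_measurable M"
  shows "(\<integral>x. f (a + x) \<partial>M) = (\<integral>x. f x \<partial>M)"
  using integral_distr[OF measurable_translation[of a], of f] assms by (simp add: distr_translation)

section \<open>Integrals of bounded functions and of continuous kernels\<close>

lemma continuous_bounded:
  fixes f :: "'g \<Rightarrow> complex"
  assumes "continuous_on UNIV f"
  obtains B where "0 < B" "\<And>x. cmod (f x) \<le> B"
proof -
  have "bounded (range f)" using compact_UNIV assms by (simp add: compact_continuous_image compact_imp_bounded)
  then show ?thesis using that by (auto simp: bounded_pos)
qed

lemma integrable_bounded:
  fixes f :: "'g \<Rightarrow> complex"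
  assumes "f \<in> borel_measurable M" "\<And>x. cmod (f x) \<le> B"
  shows "integrable M f"
  by (rule integrable_const_bound[of f B]) (use assms in auto)

lemma integrable_continuous:
  fixes f :: "'g \<Rightarrow> complex"
  assumes "continuous_on UNIV f"
  shows "integrable M f"
  by (rule continuous_bounded[OF assms]) (use integrable_bounded measurable_continuous[OF assms] in blast)

lemma norm_integral_le:
  fixes f :: "'g \<Rightarrow> complex"
  assumes "\<And>x. cmod (f x) \<le> B"
  shows "cmod (\<integral>x. f x \<partial>M) \<le> vol * B"
proof (cases "integrable M f")
  case True
  have "cmod (\<integral>x. f x \<partial>M) \<le> (\<integral>x. cmod (f x) \<partial>M)" by (rule integral_norm_bound)
  also have "\<dots> \<le> (\<integral>x. B \<partial>M)" using True assms by (intro integral_mono) auto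
  finally show ?thesis by (simp add: vol_def)
next
  case False
  \<comment> \<open>The integral of a non-integrable function is 0, so the estimate survives as soon
    as \<open>B\<close> is nonnegative.\<close>
  have "0 \<le> B" using assms[of 0] norm_ge_zero order_trans by blast
  then show ?thesis using False vol_pos by (simp add: not_integrable_integral_eq)
qed

text \<open>The factor \<open>g\<close> is only integrable, which is what elements of M^\<Psi> will
  supply; all continuity in \<open>y\<close> comes from the kernel, whose slices vary continuously
  in the supremum norm.\<close>

lemma continuous_integral_param:
  fixes H :: "'g \<Rightarrow> 'g \<Rightarrow> complex"
  assumes H: "continuous_on UNIV (\<lambda>(y, x). H y x)" and g: "integrable M g"
  shows "continuous_on UNIV (\<lambda>y. \<integral>x. H y x * g x \<partial>M)"
    and "integrable M (\<lambda>x. H y x * g x)"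
proof -
  have [measurable]: "g \<in> borel_measurable M" using g by auto
  have int: "integrable M (\<lambda>x. H y x * g x)" for y
  proof -
    have c: "continuous_on UNIV (H y)" using continuous_on_curried[OF H] by simp
    note [measurable] = measurable_continuous[OF c]
    obtain B where B: "\<And>x. cmod (H y x) \<le> B" using continuous_bounded[OF c] by blast
    show ?thesis
    proof (rule Bochner_Integration.integrable_bound)
      show "integrable M (\<lambda>x. B * cmod (g x))" using g by auto
      show "AE x in M. cmod (H y x * g x) \<le> norm (B * cmod (g x))"
        using B by (auto simp: norm_mult intro!: AE_I2 mult_right_mono order_trans[OF _ abs_ge_self])
    qed measurable
  qed
  show "integrable M (\<lambda>x. H y x * g x)" by (rule int)
  \<comment> \<open>The added 1 keeps \<open>K\<close> positive when \<open>g\<close> vanishes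
    almost everywhere and makes the final inequality strict.\<close>
  define K where "K = (\<integral>x. cmod (g x) \<partial>M) + 1"
  have K: "0 < K" unfolding K_def by (rule add_nonneg_pos) auto
  show "continuous_on UNIV (\<lambda>y. \<integral>x. H y x * g x \<partial>M)"
    unfolding continuous_on_def tendsto_iff
  proof safe
    fix y0 :: 'g and e :: real assume e: "0 < e"
    then have "0 < e / K" using K by simp
    from uniform_slices[OF compact_UNIV H this, of y0]
    obtain X where X: "y0 \<in> X" "open X" "\<And>y x. y \<in> X \<Longrightarrow> cmod (H y x - H y0 x) \<le> e / K" by blast
    have "dist (\<integral>x. H y x * g x \<partial>M) (\<integral>x. H y0 x * g x \<partial>M) < e" if "y \<in> X" for y
    proof -
      have "(\<integral>x. H y x * g x \<partial>M) - (\<integral>x. H y0 x * g x \<partial>M) = (\<integral>x. (H y x - H y0 x) * g x \<partial>M)"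
        using int by (subst Bochner_Integration.integral_diff[symmetric]) (auto simp: algebra_simps)
      also have "cmod \<dots> \<le> (\<integral>x. cmod ((H y x - H y0 x) * g x) \<partial>M)" by (rule integral_norm_bound)
      also have "\<dots> \<le> (\<integral>x. e / K * cmod (g x) \<partial>M)"
      proof (rule integral_mono)
        show "integrable M (\<lambda>x. cmod ((H y x - H y0 x) * g x))"
          using Bochner_Integration.integrable_diff[OF int[of y] int[of y0]]
          by (auto simp: left_diff_distrib)
        show "cmod ((H y x - H y0 x) * g x) \<le> e / K * cmod (g x)" for x
          unfolding norm_mult by (intro mult_right_mono X(3)[OF that]) simp
      qed (use g in auto)
      also have "\<dots> = e / K * (K - 1)" by (simp add: K_def)
      also have "\<dots> < e" using K e by (simp add: field_simps)
      finally show ?thesis by (simp add: dist_norm)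
    qed
    then show "\<forall>\<^sub>F y in at y0 within UNIV. dist (\<integral>x. H y x * g x \<partial>M) (\<integral>x. H y0 x * g x \<partial>M) < e"
      using X eventually_at_topological by blast
  qed
qed

lemma integral_finite_range:
  fixes \<psi> :: "'g \<Rightarrow> complex"
  assumes "finite (range p)" "\<And>i. p -` {i} \<in> sets borel"
  shows "(\<integral>y. \<psi> (p y) \<partial>M) = (\<Sum>i\<in>range p. complex_of_real (measure M (p -` {i})) * \<psi> i)"
    and "integrable M (\<lambda>y. \<psi> (p y))"
proof -
  have eq: "\<psi> (p y) = (\<Sum>i\<in>range p. indicator (p -` {i}) y *\<^sub>R \<psi> i)" for y
  proof -
    have "(\<Sum>i\<in>range p. indicator (p -` {i}) y *\<^sub>R \<psi> i) = (\<Sum>i\<in>range p. if i = p y then \<psi> i else 0)"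
      by (rule sum.cong) (auto simp: indicator_def)
    then show ?thesis using assms(1) by simp
  qed
  have int: "integrable M (\<lambda>y. indicator (p -` {i}) y *\<^sub>R \<psi> i)" for i
    using assms(2) by (intro integrable_indicator) (auto simp: less_top[symmetric])
  show "integrable M (\<lambda>y. \<psi> (p y))" unfolding eq using int by (intro Bochner_Integration.integrable_sum)
  show "(\<integral>y. \<psi> (p y) \<partial>M) = (\<Sum>i\<in>range p. complex_of_real (measure M (p -` {i})) * \<psi> i)"
    unfolding eq using int assms(2)
    by (subst Bochner_Integration.integral_sum) (auto simp: scaleR_conv_of_real less_top[symmetric])
qed

text \<open>The integral of a jointly continuous kernel is a uniform limit of finite linear
  combinations of its slices, so that no vector-valued integration is needed.\<close>

lemma functional_integral:
  fixes F :: "('g \<Rightarrow> complex) \<Rightarrow> complex" and H :: "'g \<Rightarrow> 'g \<Rightarrow> complex"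
  assumes H: "continuous_on UNIV (\<lambda>(y, x). H y x)"
    and add: "\<And>a b. continuous_on UNIV a \<Longrightarrow> continuous_on UNIV b \<Longrightarrow> F (\<lambda>x. a x + b x) = F a + F b"
    and scale: "\<And>c a. continuous_on UNIV a \<Longrightarrow> F (\<lambda>x. c * a x) = c * F a"
    and bound: "\<And>a B. continuous_on UNIV a \<Longrightarrow> 0 < B \<Longrightarrow> (\<And>x. cmod (a x) \<le> B) \<Longrightarrow> cmod (F a) \<le> K * B"
  shows "F (\<lambda>x. \<integral>y. H y x \<partial>M) = (\<integral>y. F (H y) \<partial>M)"
    and "continuous_on UNIV (\<lambda>y. F (H y))"
proof -
  \<comment> \<open>The bound for the zero function at \<open>B = 1\<close> forces this.\<close>
  have K: "0 \<le> K"
    using bound[of "\<lambda>_. 0" 1] order_trans[OF norm_ge_zero] by (fastforce simp: continuous_on_const)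
  note cont = continuous_on_curried[OF H]
  have diff: "F (\<lambda>x. a x - b x) = F a - F b" if "continuous_on UNIV a" "continuous_on UNIV b" for a b
    using add[of a "\<lambda>x. (-1) * b x"] scale[of b "-1"] that by (simp add: continuous_on_minus)
  have zero: "F (\<lambda>x. 0) = 0" using scale[of "\<lambda>_. 0" 0] by (simp add: continuous_on_const)
  have sum: "F (\<lambda>x. \<Sum>i\<in>I. c i * H i x) = (\<Sum>i\<in>I. c i * F (H i))" if "finite I" for I c
    using that
  proof induction
    case (insert i I)
    have "F (\<lambda>x. c i * H i x + (\<Sum>i\<in>I. c i * H i x)) = F (\<lambda>x. c i * H i x) + F (\<lambda>x. \<Sum>i\<in>I. c i * H i x)"
      by (intro add continuous_intros cont)
    then show ?case using insert scale[OF cont(1)] by simp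
  qed (simp add: zero)
  show cF: "continuous_on UNIV (\<lambda>y. F (H y))"
    unfolding continuous_on_def tendsto_iff
  proof safe
    fix y0 :: 'g and e :: real assume e: "0 < e"
    then have e': "0 < e / (K + 1)" using K by simp
    from uniform_slices[OF compact_UNIV H this, of y0]
    obtain X where X: "y0 \<in> X" "open X" "\<And>y x. y \<in> X \<Longrightarrow> cmod (H y x - H y0 x) \<le> e / (K + 1)" by blast
    have "dist (F (H y)) (F (H y0)) < e" if "y \<in> X" for y
    proof -
      have "cmod (F (\<lambda>x. H y x - H y0 x)) \<le> K * (e / (K + 1))"
        using X(3)[OF that] e' by (intro bound continuous_intros cont) auto
      also have "\<dots> < e" using K e by (simp add: field_simps)
      finally show ?thesis by (simp add: dist_norm diff cont)
    qed
    then show "\<forall>\<^sub>F y in at y0 within UNIV. dist (F (H y)) (F (H y0)) < e"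
      using X eventually_at_topological by blast
  qed
  have swap: "continuous_on UNIV (\<lambda>(x, y). H y x)"
    using continuous_on_compose2[OF H continuous_on_swap, of UNIV]
    by (simp add: split_beta prod.swap_def)
  have cI: "continuous_on UNIV (\<lambda>x. \<integral>y. H y x \<partial>M)"
    using continuous_integral_param(1)[OF swap, of "\<lambda>_. 1"] by simp
  have "cmod (F (\<lambda>x. \<integral>y. H y x \<partial>M) - (\<integral>y. F (H y) \<partial>M)) \<le> 0 + e" if e: "0 < e" for e
  proof -
    \<comment> \<open>Each of the two errors below is at most \<open>K * vol * d\<close>; the added
      1 keeps the denominator positive when \<open>K = 0\<close>.\<close>
    define d where "d = e / (2 * K * vol + 1)"
    have d: "0 < d" unfolding d_def using e K vol_pos by (auto intro!: divide_pos_pos add_nonneg_pos)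
    obtain p where p: "finite (range p)" "\<And>i. p -` {i} \<in> sets borel"
      "\<And>y x. cmod (H y x - H (p y) x) \<le> d"
      using finite_borel_approx[OF compact_UNIV compact_UNIV H d] by blast
    \<comment> \<open>\<open>S\<close> is a Riemann sum of slices, and \<open>F S\<close> is the
      integral of the step function \<open>F (H (p y))\<close>.\<close>
    define S where "S = (\<lambda>x. \<Sum>i\<in>range p. complex_of_real (measure M (p -` {i})) * H i x)"
    have cS: "continuous_on UNIV S" unfolding S_def by (intro continuous_intros cont)
    have FS: "F S = (\<integral>y. F (H (p y)) \<partial>M)"
      unfolding S_def sum[OF p(1)] by (rule integral_finite_range(1)[OF p(1,2), symmetric])
    have 1: "cmod (F (\<lambda>x. \<integral>y. H y x \<partial>M) - F S) \<le> K * (vol * d)"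
    proof -
      have "cmod ((\<integral>y. H y x \<partial>M) - S x) \<le> vol * d" for x
      proof -
        have "(\<integral>y. H y x \<partial>M) - S x = (\<integral>y. H y x - H (p y) x \<partial>M)"
          unfolding S_def integral_finite_range(1)[OF p(1,2), of "\<lambda>i. H i x", symmetric]
          by (intro Bochner_Integration.integral_diff[symmetric] integrable_continuous cont
              integral_finite_range(2)[OF p(1,2)])
        then show ?thesis using norm_integral_le[of "\<lambda>y. H y x - H (p y) x"] p(3) by simp
      qed
      then have "cmod (F (\<lambda>x. (\<integral>y. H y x \<partial>M) - S x)) \<le> K * (vol * d)"
        using d vol_pos by (intro bound continuous_intros cI cS) auto
      then show ?thesis by (simp add: diff cI cS)
    qed
    have 2: "cmod ((\<integral>y. F (H y) \<partial>M) - F S) \<le> vol * (K * d)"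
    proof -
      have "(\<integral>y. F (H y) \<partial>M) - F S = (\<integral>y. F (H y) - F (H (p y)) \<partial>M)"
        unfolding FS by (intro Bochner_Integration.integral_diff[symmetric] integrable_continuous cF
            integral_finite_range(2)[OF p(1,2)])
      moreover have "cmod (F (H y) - F (H (p y))) \<le> K * d" for y
        unfolding diff[OF cont(1) cont(1), symmetric]
        using p(3) d by (intro bound continuous_intros cont) auto
      ultimately show ?thesis using norm_integral_le by simp
    qed
    have "cmod (F (\<lambda>x. \<integral>y. H y x \<partial>M) - (\<integral>y. F (H y) \<partial>M)) \<le> K * (vol * d) + vol * (K * d)"
      using norm_triangle_ineq4[of "F (\<lambda>x. \<integral>y. H y x \<partial>M) - F S" "(\<integral>y. F (H y) \<partial>M) - F S"] 1 2
      by (auto simp only: diff_diff_eq2 diff_add_cancel intro: order_trans add_mono)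
    also have "\<dots> = (2 * K * vol) * d" by simp
    also have "\<dots> \<le> (2 * K * vol + 1) * d" using d by simp
    also have "\<dots> = e" unfolding d_def using K vol_pos
      by (simp add: add_nonneg_pos less_imp_neq[symmetric])
    finally show ?thesis by simp
  qed
  then have "cmod (F (\<lambda>x. \<integral>y. H y x \<partial>M) - (\<integral>y. F (H y) \<partial>M)) \<le> 0" by (rule field_le_epsilon)
  then show "F (\<lambda>x. \<integral>y. H y x \<partial>M) = (\<integral>y. F (H y) \<partial>M)" by simp
qed

text \<open>An instance of \<open>functional_integral\<close>: integration against \<open>g\<close>
  is a functional bounded in the supremum norm by the L^1 norm of \<open>g\<close>. No product
  measure enters.\<close>

lemma fubini_continuous:
  fixes H :: "'g \<Rightarrow> 'g \<Rightarrow> complex"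
  assumes H: "continuous_on UNIV (\<lambda>(y, x). H y x)" and g: "integrable M g"
  shows "(\<integral>y. (\<integral>x. H y x * g x \<partial>M) \<partial>M) = (\<integral>x. (\<integral>y. H y x \<partial>M) * g x \<partial>M)"
proof -
  have [measurable]: "g \<in> borel_measurable M" using g by auto
  have int: "integrable M (\<lambda>x. a x * g x)" if "continuous_on UNIV a" for a :: "'g \<Rightarrow> complex"
    using continuous_integral_param(2)[OF _ g, of "\<lambda>y x. a x"] that
      continuous_on_compose2[OF that, of UNIV snd] by (simp add: split_beta continuous_on_snd)
  show ?thesis
  proof (rule functional_integral(1)[OF H, where K = "\<integral>x. cmod (g x) \<partial>M", symmetric])
    fix a :: "'g \<Rightarrow> complex" and B assume a: "continuous_on UNIV a" "\<And>x. cmod (a x) \<le> B"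
    have "cmod (\<integral>x. a x * g x \<partial>M) \<le> (\<integral>x. cmod (a x * g x) \<partial>M)" by (rule integral_norm_bound)
    also have "\<dots> \<le> (\<integral>x. B * cmod (g x) \<partial>M)"
      using integrable_norm[OF int[OF a(1)]] g a(2)
      by (intro integral_mono) (auto simp: norm_mult intro!: mult_right_mono)
    finally show "cmod (\<integral>x. a x * g x \<partial>M) \<le> (\<integral>x. cmod (g x) \<partial>M) * B" by (simp add: mult.commute)
  qed (auto simp: distrib_right mult.assoc int)
qed

text \<open>Integrating \<open>f (x - y)\<close> over both variables gives \<open>vol\<close> times
  either side, according to the order of integration. This replaces the usual appeal to uniqueness
  of Haar measure.\<close>

lemma integral_inversion:
  fixes f :: "'g \<Rightarrow> complex"
  assumes f: "continuous_on UNIV f"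
  shows "(\<integral>x. f (- x) \<partial>M) = (\<integral>x. f x \<partial>M)"
proof -
  have c: "continuous_on UNIV (\<lambda>(y, x). f (x - y))"
    unfolding split_beta by (rule continuous_on_compose2[OF f]) (auto intro!: continuous_intros)
  have cm: "continuous_on UNIV (\<lambda>x. f (- x))"
    by (rule continuous_on_compose2[OF f]) (auto intro!: continuous_intros)
  have 1: "(\<integral>x. f (x - y) \<partial>M) = (\<integral>x. f x \<partial>M)" for y
    using integral_translation[OF measurable_continuous[OF f], of "- y"] by simp
  have 2: "(\<integral>y. f (x - y) \<partial>M) = (\<integral>x. f (- x) \<partial>M)" for x
    using integral_translation[OF measurable_continuous[OF cm], of "- x"] by simp
  have "complex_of_real vol * (\<integral>x. f x \<partial>M) = complex_of_real vol * (\<integral>x. f (- x) \<partial>M)"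
    using fubini_continuous[OF c, of "\<lambda>_. 1"] by (simp add: 1 2 vol_def scaleR_conv_of_real)
  then show ?thesis using vol_pos by simp
qed

text \<open>Outer regularity for \<open>B\<close> and for its complement gives open sets
  \<open>U\<close> and \<open>V\<close> that together cover the group. Their complements are
  disjoint closed sets, and a Urysohn function that is 0 off \<open>U\<close> and 1 off
  \<open>V\<close> can differ from the indicator only on the two small excess sets.\<close>

lemma continuous_approx_indicator:
  assumes B: "B \<in> sets borel" and e: "0 < e"
  obtains h :: "'g \<Rightarrow> real" and E where "continuous_on UNIV h" "\<And>x. 0 \<le> h x" "\<And>x. h x \<le> 1"
    "E \<in> sets borel" "emeasure M E \<le> ennreal e" "\<And>x. x \<notin> E \<Longrightarrow> h x = indicator B x"
proof -
  have outer: "\<exists>U. open U \<and> A \<subseteq> U \<and> emeasure M (U - A) \<le> ennreal (e / 2)" if A: "A \<in> sets borel" for A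
  proof -
    have "(INF U\<in>{U. open U \<and> A \<subseteq> U}. emeasure M U) = emeasure M A"
      using haar_outer_regular[OF A] by simp
    also have "\<dots> < emeasure M A + ennreal (e / 2)"
      using e ennreal_add_left_cancel_less[of "emeasure M A" 0 "ennreal (e/2)"] by (simp add: less_top[symmetric])
    finally obtain U where U: "open U" "A \<subseteq> U" "emeasure M U < emeasure M A + ennreal (e / 2)"
      by (auto simp: INF_less_iff)
    have "emeasure M (U - A) = emeasure M U - emeasure M A"
      using U A by (intro emeasure_Diff) auto
    also have "\<dots> \<le> ennreal (e / 2)"
      using U(3) by (intro ennreal_minus_le_iff[THEN iffD2]) (auto simp: add.commute)
    finally show ?thesis using U by blast
  qed
  obtain U where U: "open U" "B \<subseteq> U" "emeasure M (U - B) \<le> ennreal (e / 2)" using outer[OF B] by blast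
  obtain V where V: "open V" "- B \<subseteq> V" "emeasure M (V - (- B)) \<le> ennreal (e / 2)"
    using outer[of "- B"] B by auto
  have "normal_space (euclidean :: 'g topology)"
  proof (rule compact_Hausdorff_or_regular_imp_normal_space)
    show "compact_space (euclidean :: 'g topology)" using compact_UNIV by (simp add: compact_space_def)
    have "Hausdorff_space (euclidean :: 'g topology)"
      unfolding Hausdorff_space_def by (simp add: disjnt_def) (metis hausdorff)
    then show "Hausdorff_space (euclidean :: 'g topology) \<or> regular_space (euclidean :: 'g topology)" ..
  qed
  moreover have "closedin euclidean (- U)" "closedin euclidean (- V)" using U V by (auto simp: closed_closedin[symmetric])
  moreover have "disjnt (- U) (- V)" using U V by (auto simp: disjnt_def)
  ultimately obtain h :: "'g \<Rightarrow> real" where h: "continuous_map euclidean (top_of_set {0..1}) h"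
    "h ` (- U) \<subseteq> {0}" "h ` (- V) \<subseteq> {1}"
    using Urysohn_lemma[of euclidean "- U" "- V" 0 1] by auto
  have r: "range h \<subseteq> {0..1}" "continuous_on UNIV h" using h(1) by (auto simp: continuous_map_in_subtopology)
  then have "0 \<le> h x" "h x \<le> 1" for x by (auto simp: image_subset_iff)
  show ?thesis
  proof (rule that[of h "(U - B) \<union> (V - (- B))"])
    have "emeasure M ((U - B) \<union> (V - (- B))) \<le> emeasure M (U - B) + emeasure M (V - (- B))"
      using U V B by (intro emeasure_subadditive) auto
    also have "\<dots> \<le> ennreal (e/2) + ennreal (e/2)" using U V by (intro add_mono) auto
    also have "\<dots> = ennreal e" using e by (simp add: ennreal_plus[symmetric] del: ennreal_plus)
    finally show "emeasure M ((U - B) \<union> (V - (- B))) \<le> ennreal e" .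
    show "h x = indicator B x" if "x \<notin> (U - B) \<union> (V - (- B))" for x
      using that h(2,3) U(2) V(2) by (cases "x \<in> B") auto
  qed (use r(2) \<open>\<And>x. 0 \<le> h x\<close> \<open>\<And>x. h x \<le> 1\<close> U V B in auto)
qed

end

section \<open>Orlicz spaces\<close>

locale orlicz = compact_haar M for M :: "'g::{topological_ab_group_add, t2_space} measure" +
  fixes \<Phi> :: "real \<Rightarrow> real"
  assumes N_function: "N_function \<Phi>"
begin

abbreviation "\<Psi> \<equiv> complementary \<Phi>"
abbreviation "M\<Phi> \<equiv> M_space M \<Phi>"
abbreviation "M\<Psi> \<equiv> M_space M (complementary \<Phi>)"
abbreviation "nrm\<Phi> \<equiv> luxemburg_norm M \<Phi>"
abbreviation "nrm\<Psi> \<equiv> dual_orlicz_norm M \<Phi>"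

section \<open>N-functions and Young's inequality\<close>

lemma \<Phi>_nonneg [simp]: "0 \<le> \<Phi> x" and \<Phi>_0 [simp]: "\<Phi> 0 = 0" and \<Phi>_convex: "convex_on UNIV \<Phi>"
  using N_function by (auto simp: N_function_def)

lemma \<Phi>_scale: "0 \<le> c \<Longrightarrow> c \<le> 1 \<Longrightarrow> \<Phi> (c * t) \<le> c * \<Phi> t"
  using convex_onD[OF \<Phi>_convex, of c 0 t] by simp

lemma \<Phi>_mono: "0 \<le> s \<Longrightarrow> s \<le> t \<Longrightarrow> \<Phi> s \<le> \<Phi> t"
proof (cases "t = 0")
  case False
  assume st: "0 \<le> s" "s \<le> t"
  then have "\<Phi> (s / t * t) \<le> s / t * \<Phi> t" using False by (intro \<Phi>_scale) auto
  also have "\<dots> \<le> \<Phi> t" using st False by (intro mult_left_le_one_le) auto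
  finally show ?thesis using False by simp
qed simp

lemma \<Phi>_continuous: "continuous_on UNIV \<Phi>"
  by (rule convex_on_continuous[OF open_UNIV \<Phi>_convex])

lemma \<Phi>_measurable [measurable]: "\<Phi> \<in> borel_measurable borel"
  by (rule borel_measurable_continuous_onI[OF \<Phi>_continuous])

text \<open>Superlinear growth of \<open>\<Phi>\<close> bounds the family; without a bound the
  real-valued \<open>SUP\<close> in \<open>complementary\<close> would carry no information.\<close>

lemma bdd_above_complementary: "bdd_above ((\<lambda>x. x * \<bar>y\<bar> - \<Phi> x) ` {0..})"
proof -
  have "filterlim (\<lambda>x. \<Phi> x / x) at_top at_top" using N_function by (simp add: N_function_def)
  then have "eventually (\<lambda>x. \<bar>y\<bar> \<le> \<Phi> x / x) at_top" by (simp add: filterlim_at_top)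
  then obtain X where X: "\<And>x. X \<le> x \<Longrightarrow> \<bar>y\<bar> \<le> \<Phi> x / x" by (auto simp: eventually_at_top_linorder)
  \<comment> \<open>The maximum with 1 makes every \<open>x\<close> beyond \<open>Y\<close>
    positive, so that the quotient \<open>\<Phi> x / x\<close> can be cleared.\<close>
  define Y where "Y = max X 1"
  have "x * \<bar>y\<bar> - \<Phi> x \<le> Y * \<bar>y\<bar>" if "0 \<le> x" for x
  proof (cases "x \<le> Y")
    case True
    then have "x * \<bar>y\<bar> \<le> Y * \<bar>y\<bar>" by (intro mult_right_mono) auto
    then show ?thesis using \<Phi>_nonneg[of x] by linarith
  next
    case False
    then have x: "X \<le> x" "0 < x" by (auto simp: Y_def)
    then have "x * \<bar>y\<bar> \<le> \<Phi> x" using X[OF x(1)] by (simp add: field_simps)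
    moreover have "0 \<le> Y * \<bar>y\<bar>" by (simp add: Y_def)
    ultimately show ?thesis by linarith
  qed
  then show ?thesis by (auto simp: bdd_above_def)
qed

lemma young: "0 \<le> x \<Longrightarrow> x * \<bar>y\<bar> \<le> \<Phi> x + \<Psi> y"
  using cSUP_upper[OF _ bdd_above_complementary, of x y] by (simp add: complementary_def)

lemma \<Psi>_nonneg [simp]: "0 \<le> \<Psi> y"
  using young[of 0 y] by simp

lemma \<Psi>_mono: "\<bar>y\<bar> \<le> \<bar>z\<bar> \<Longrightarrow> \<Psi> y \<le> \<Psi> z"
  unfolding complementary_def
  by (rule cSUP_mono) (auto intro!: bdd_above_complementary mult_left_mono bexI simp: diff_right_mono)

lemma \<Psi>_measurable:
  fixes g :: "'g \<Rightarrow> complex"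
  assumes [measurable]: "g \<in> borel_measurable M"
  shows "(\<lambda>x. \<Psi> (cmod (g x))) \<in> borel_measurable M"
proof -
  \<comment> \<open>\<open>\<Psi>\<close> is monotone in the absolute value; cutting off the
    negative half-line makes it monotone on all reals, hence Borel.\<close>
  have [measurable]: "(\<lambda>y. \<Psi> (max 0 y)) \<in> borel_measurable borel"
    by (intro borel_measurable_mono monoI \<Psi>_mono) auto
  have "(\<lambda>x. \<Psi> (max 0 (cmod (g x)))) \<in> borel_measurable M" by measurable
  then show ?thesis by simp
qed

section \<open>Luxemburg norm, Orlicz norm and Hoelder's inequality\<close>

lemma modular_mono:
  assumes "\<And>x. cmod (f x) \<le> cmod (g x)"
  shows "modular M \<Phi> f \<le> modular M \<Phi> g"
  unfolding modular_def using assms by (intro nn_integral_mono ennreal_leI \<Phi>_mono) auto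

lemma M\<Phi>_measurable: "f \<in> M\<Phi> \<Longrightarrow> f \<in> borel_measurable M"
  and M\<Psi>_measurable: "g \<in> M\<Psi> \<Longrightarrow> g \<in> borel_measurable M"
  by (auto simp: M_space_def)

lemma lux_le: "0 < k \<Longrightarrow> modular M \<Phi> (\<lambda>x. f x / of_real k) \<le> 1 \<Longrightarrow> nrm\<Phi> f \<le> ennreal k"
  unfolding luxemburg_norm_def by (intro INF_lower) auto

lemma lux_lessD: "nrm\<Phi> f < c \<Longrightarrow> \<exists>k>0. modular M \<Phi> (\<lambda>x. f x / of_real k) \<le> 1 \<and> ennreal k < c"
  by (auto simp: luxemburg_norm_def INF_less_iff)

text \<open>With \<open>r\<close> the modular of \<open>f\<close>, convexity makes the modular of
  \<open>f / (r + 1)\<close> at most \<open>r / (r + 1)\<close>, so \<open>r + 1\<close> is an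
  admissible gauge.\<close>

lemma lux_finite:
  assumes f: "f \<in> M\<Phi>" shows "nrm\<Phi> f < \<infinity>"
proof -
  note [measurable] = M\<Phi>_measurable[OF f]
  have "\<forall>a>0. modular M \<Phi> (\<lambda>x. complex_of_real a * f x) < \<infinity>" using f by (simp add: M_space_def)
  from this[rule_format, of 1] have fin: "modular M \<Phi> f < \<infinity>" by simp
  then obtain r where r: "0 \<le> r" "modular M \<Phi> f = ennreal r" by (auto simp: less_top_ennreal)
  have "modular M \<Phi> (\<lambda>x. f x / of_real (r + 1)) \<le> (\<integral>\<^sup>+x. ennreal (1 / (r + 1)) * ennreal (\<Phi> (cmod (f x))) \<partial>M)"
    unfolding modular_def
  proof (rule nn_integral_mono)
    fix x
    have "\<Phi> (1 / (r + 1) * cmod (f x)) \<le> 1 / (r + 1) * \<Phi> (cmod (f x))" using r by (intro \<Phi>_scale) auto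
    then show "ennreal (\<Phi> (cmod (f x / of_real (r + 1)))) \<le> ennreal (1 / (r + 1)) * ennreal (\<Phi> (cmod (f x)))"
      using r by (simp add: ennreal_mult[symmetric] norm_divide ennreal_leI del: of_real_add)
  qed
  also have "\<dots> = ennreal (1 / (r + 1)) * ennreal r"
    using r by (subst nn_integral_cmult) (auto simp: modular_def)
  also have "\<dots> \<le> 1"
    using r by (simp add: ennreal_mult[symmetric] divide_le_eq ennreal_le_1)
  finally have "nrm\<Phi> f \<le> ennreal (r + 1)" using r by (intro lux_le) auto
  then show ?thesis using le_less_trans by fastforce
qed

text \<open>Formulated for an admissible gauge \<open>k\<close> instead of the norm, so that
  attainment of the infimum in the Luxemburg norm is not an issue: \<open>f / k\<close> lies in the
  unit ball that defines \<open>nrm\<Psi>\<close>.\<close>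

lemma holder_gauge:
  assumes [measurable]: "f \<in> borel_measurable M" "g \<in> borel_measurable M"
    and k: "0 < k" "modular M \<Phi> (\<lambda>x. f x / of_real k) \<le> 1"
  shows "(\<integral>\<^sup>+x. ennreal (cmod (f x * g x)) \<partial>M) \<le> ennreal k * nrm\<Psi> g"
proof -
  have "nrm\<Phi> (\<lambda>x. f x / of_real k) \<le> ennreal 1" using k by (intro lux_le) auto
  then have "(\<integral>\<^sup>+x. ennreal (cmod (f x / of_real k * g x)) \<partial>M) \<le> nrm\<Psi> g"
    unfolding dual_orlicz_norm_def by (intro SUP_upper) auto
  then have "ennreal k * (\<integral>\<^sup>+x. ennreal (cmod (f x / of_real k * g x)) \<partial>M) \<le> ennreal k * nrm\<Psi> g"
    by (intro mult_left_mono) auto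
  moreover have "ennreal k * (\<integral>\<^sup>+x. ennreal (cmod (f x / of_real k * g x)) \<partial>M)
      = (\<integral>\<^sup>+x. ennreal (cmod (f x * g x)) \<partial>M)"
    using k by (subst nn_integral_cmult[symmetric])
      (auto intro!: nn_integral_cong simp: ennreal_mult[symmetric] norm_mult norm_divide)
  ultimately show ?thesis by simp
qed

text \<open>Young's inequality, integrated: the pairing is bounded by two modulars, and that of
  \<open>g\<close> is finite by membership in M^\<Psi>.\<close>

lemma dual_finite:
  assumes g: "g \<in> M\<Psi>" shows "nrm\<Psi> g < \<infinity>"
proof -
  note [measurable] = M\<Psi>_measurable[OF g] \<Psi>_measurable[OF M\<Psi>_measurable[OF g]]
  have "\<forall>a>0. modular M \<Psi> (\<lambda>x. complex_of_real a * g x) < \<infinity>" using g by (simp add: M_space_def)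
  from this[rule_format, of 1] have fin: "modular M \<Psi> g < \<infinity>" by simp
  have "nrm\<Psi> g \<le> 2 * (1 + modular M \<Psi> g)"
    unfolding dual_orlicz_norm_def
  proof (rule SUP_least)
    fix f assume "f \<in> {f \<in> borel_measurable M. nrm\<Phi> f \<le> 1}"
    \<comment> \<open>Norm at most 1 yields gauges only above the norm; choosing one below 2 is the
      source of the factor 2.\<close>
    then have [measurable]: "f \<in> borel_measurable M" and "nrm\<Phi> f < 2"
      using le_less_trans[of "nrm\<Phi> f" 1 2] by (auto simp: one_less_numeral)
    then obtain k where k: "0 < k" "modular M \<Phi> (\<lambda>x. f x / of_real k) \<le> 1" "ennreal k < 2"
      using lux_lessD by blast
    then have k2: "k \<le> 2" by (metis ennreal_numeral ennreal_less_iff less_imp_le)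
    have "(\<integral>\<^sup>+x. ennreal (cmod (f x * g x)) \<partial>M)
        \<le> (\<integral>\<^sup>+x. 2 * (ennreal (\<Phi> (cmod (f x / of_real k))) + ennreal (\<Psi> (cmod (g x)))) \<partial>M)"
    proof (rule nn_integral_mono)
      fix x
      have "cmod (f x * g x) = k * (cmod (f x / of_real k) * \<bar>cmod (g x)\<bar>)"
        using k by (simp add: norm_mult norm_divide)
      also have "\<dots> \<le> 2 * (\<Phi> (cmod (f x / of_real k)) + \<Psi> (cmod (g x)))"
        using k k2 by (intro mult_mono young) auto
      finally have "ennreal (cmod (f x * g x)) \<le> ennreal (2 * (\<Phi> (cmod (f x / of_real k)) + \<Psi> (cmod (g x))))"
        by (rule ennreal_leI)
      then show "ennreal (cmod (f x * g x)) \<le> 2 * (ennreal (\<Phi> (cmod (f x / of_real k))) + ennreal (\<Psi> (cmod (g x))))"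
        by (simp only: ennreal_mult'[of 2, simplified] ennreal_plus \<Phi>_nonneg \<Psi>_nonneg ennreal_numeral)
    qed
    also have "\<dots> = 2 * (modular M \<Phi> (\<lambda>x. f x / of_real k) + modular M \<Psi> g)"
      unfolding modular_def by (subst nn_integral_cmult, measurable, subst nn_integral_add, measurable)
    also have "\<dots> \<le> 2 * (1 + modular M \<Psi> g)" using k by (intro mult_left_mono add_right_mono) auto
    finally show "(\<integral>\<^sup>+x. ennreal (cmod (f x * g x)) \<partial>M) \<le> 2 * (1 + modular M \<Psi> g)" .
  qed
  also have "\<dots> < \<infinity>" using fin by (simp add: ennreal_mult_eq_top_iff less_top[symmetric])
  finally show ?thesis .
qed

text \<open>The infimum over gauges in \<open>holder_gauge\<close>. It is taken after division by
  \<open>nrm\<Psi> g\<close>, hence the separate case of dual norm 0.\<close>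

lemma holder:
  assumes f: "f \<in> M\<Phi>" and g: "g \<in> M\<Psi>"
  shows "(\<integral>\<^sup>+x. ennreal (cmod (f x * g x)) \<partial>M) \<le> nrm\<Phi> f * nrm\<Psi> g" (is "?I \<le> _")
proof (cases "nrm\<Psi> g = 0")
  case True
  obtain k where "0 < k" "modular M \<Phi> (\<lambda>x. f x / of_real k) \<le> 1"
    using lux_lessD[of f \<infinity>] lux_finite[OF f] by auto
  then show ?thesis
    using holder_gauge[OF M\<Phi>_measurable[OF f] M\<Psi>_measurable[OF g]] True by fastforce
next
  case False
  have fin: "nrm\<Psi> g \<noteq> top" using dual_finite[OF g] by simp
  have "?I / nrm\<Psi> g \<le> nrm\<Phi> f"
    unfolding luxemburg_norm_def
  proof (rule INF_greatest)
    fix k assume "k \<in> {k. 0 < k \<and> modular M \<Phi> (\<lambda>x. f x / complex_of_real k) \<le> 1}"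
    then have "?I \<le> ennreal k * nrm\<Psi> g"
      using holder_gauge[OF M\<Phi>_measurable[OF f] M\<Psi>_measurable[OF g]] by auto
    then have "?I / nrm\<Psi> g \<le> ennreal k * nrm\<Psi> g / nrm\<Psi> g" by (rule divide_right_mono_ennreal)
    then show "?I / nrm\<Psi> g \<le> ennreal k" using False fin by (simp add: ennreal_mult_divide_eq)
  qed
  then have "?I / nrm\<Psi> g * nrm\<Psi> g \<le> nrm\<Phi> f * nrm\<Psi> g" by (intro mult_right_mono) auto
  then show ?thesis using ennreal_mult_divide_eq[OF False fin, of ?I]
    by (simp add: ennreal_divide_times ennreal_times_divide)
qed

lemma holder_integrable:
  assumes f: "f \<in> M\<Phi>" and g: "g \<in> M\<Psi>"
  shows "integrable M (\<lambda>x. f x * g x)"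
    and "cmod (\<integral>x. f x * g x \<partial>M) \<le> enn2real (nrm\<Phi> f * nrm\<Psi> g)"
proof -
  note [measurable] = M\<Phi>_measurable[OF f] M\<Psi>_measurable[OF g]
  have fin: "nrm\<Phi> f * nrm\<Psi> g < \<infinity>"
    using lux_finite[OF f] dual_finite[OF g] by (simp add: ennreal_mult_less_top)
  show int: "integrable M (\<lambda>x. f x * g x)"
    by (rule integrableI_bounded) (use holder[OF f g] fin in \<open>auto intro: le_less_trans\<close>)
  have "ennreal (cmod (\<integral>x. f x * g x \<partial>M)) \<le> nrm\<Phi> f * nrm\<Psi> g"
    using integral_norm_bound_ennreal[OF int] holder[OF f g] by (rule order_trans)
  then show "cmod (\<integral>x. f x * g x \<partial>M) \<le> enn2real (nrm\<Phi> f * nrm\<Psi> g)"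
    using fin enn2real_mono by fastforce
qed

lemma modular_translation:
  assumes [measurable]: "f \<in> borel_measurable M"
  shows "modular M \<Phi> (\<lambda>x. f (a + x)) = modular M \<Phi> f"
  unfolding modular_def
  by (rule nn_integral_translation[where f = "\<lambda>x. ennreal (\<Phi> (cmod (f x)))"]) measurable

lemma translation:
  assumes f: "f \<in> M\<Phi>"
  shows "(\<lambda>x. f (a + x)) \<in> M\<Phi>" and "nrm\<Phi> (\<lambda>x. f (a + x)) = nrm\<Phi> f"
proof -
  note m [measurable] = M\<Phi>_measurable[OF f]
  have "(\<lambda>x. f (a + x)) \<in> borel_measurable M" by (rule measurable_compose[OF measurable_translation m])
  moreover have "modular M \<Phi> (\<lambda>x. complex_of_real b * f (a + x)) = modular M \<Phi> (\<lambda>x. complex_of_real b * f x)" for b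
    by (rule modular_translation[where f = "\<lambda>x. complex_of_real b * f x"]) measurable
  ultimately show "(\<lambda>x. f (a + x)) \<in> M\<Phi>" using f by (auto simp: M_space_def)
  have "modular M \<Phi> (\<lambda>x. f (a + x) / complex_of_real b) = modular M \<Phi> (\<lambda>x. f x / complex_of_real b)" for b
    by (rule modular_translation[where f = "\<lambda>x. f x / complex_of_real b"]) measurable
  then show "nrm\<Phi> (\<lambda>x. f (a + x)) = nrm\<Phi> f" by (simp add: luxemburg_norm_def)
qed

section \<open>Bounded and continuous functions in the Orlicz spaces\<close>

lemma bounded_M\<Phi>:
  assumes "f \<in> borel_measurable M" "\<And>x. cmod (f x) \<le> B"
  shows "f \<in> M\<Phi>"
proof -
  have "modular M \<Phi> (\<lambda>x. complex_of_real a * f x) < \<infinity>" if "0 < a" for a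
  proof -
    have "modular M \<Phi> (\<lambda>x. complex_of_real a * f x) \<le> (\<integral>\<^sup>+x. ennreal (\<Phi> (a * B)) \<partial>M)"
      unfolding modular_def using that assms(2)
      by (intro nn_integral_mono ennreal_leI \<Phi>_mono) (auto simp: norm_mult intro!: mult_left_mono)
    also have "\<dots> < \<infinity>" by (simp add: emeasure_UNIV ennreal_mult_less_top)
    finally show ?thesis .
  qed
  then show ?thesis using assms(1) by (simp add: M_space_def)
qed

lemma bounded_M\<Psi>:
  assumes "f \<in> borel_measurable M" "\<And>x. cmod (f x) \<le> B"
  shows "f \<in> M\<Psi>"
proof -
  have B: "0 \<le> B" using order_trans[OF norm_ge_zero assms(2)] by blast
  have "modular M \<Psi> (\<lambda>x. complex_of_real a * f x) < \<infinity>" if "0 < a" for a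
  proof -
    have "modular M \<Psi> (\<lambda>x. complex_of_real a * f x) \<le> (\<integral>\<^sup>+x. ennreal (\<Psi> (a * B)) \<partial>M)"
      unfolding modular_def using that assms(2) B
      by (intro nn_integral_mono ennreal_leI \<Psi>_mono) (auto simp: norm_mult abs_mult intro!: mult_left_mono)
    also have "\<dots> < \<infinity>" by (simp add: emeasure_UNIV ennreal_mult_less_top)
    finally show ?thesis .
  qed
  then show ?thesis using assms(1) by (simp add: M_space_def)
qed

lemma continuous_M\<Phi>: "continuous_on UNIV f \<Longrightarrow> f \<in> M\<Phi>"
  by (rule continuous_bounded) (auto intro: bounded_M\<Phi> measurable_continuous)

lemma continuous_M\<Psi>: "continuous_on UNIV f \<Longrightarrow> f \<in> M\<Psi>"
  by (rule continuous_bounded) (auto intro: bounded_M\<Psi> measurable_continuous)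

text \<open>An explicit admissible gauge for the constant function 1, in place of its norm. It is at
  least 1, so that convexity applies to its reciprocal, and it becomes the constant by which the
  supremum norm controls \<open>nrm\<Phi>\<close>.\<close>

definition unit_gauge :: real where "unit_gauge = \<Phi> 1 * vol + 1"

lemma unit_gauge: "1 \<le> unit_gauge" "modular M \<Phi> (\<lambda>x. 1 / of_real unit_gauge) \<le> 1"
proof -
  show 1: "1 \<le> unit_gauge" using vol_pos by (simp add: unit_gauge_def)
  have "\<Phi> (1 / unit_gauge * 1) \<le> 1 / unit_gauge * \<Phi> 1" using 1 by (intro \<Phi>_scale) auto
  then have "\<Phi> (1 / unit_gauge) * vol \<le> 1 / unit_gauge * \<Phi> 1 * vol" using vol_pos by (intro mult_right_mono) auto
  also have "\<dots> \<le> 1" using 1 by (simp add: divide_le_eq) (simp add: unit_gauge_def)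
  finally show "modular M \<Phi> (\<lambda>x. 1 / of_real unit_gauge) \<le> 1"
    using 1 vol_pos by (simp add: modular_def norm_divide emeasure_UNIV ennreal_mult[symmetric] ennreal_le_1)
qed

lemma lux_bounded:
  assumes "0 < B" "\<And>x. cmod (f x) \<le> B"
  shows "nrm\<Phi> f \<le> ennreal (unit_gauge * B)"
proof (rule lux_le)
  show "0 < unit_gauge * B" using assms unit_gauge by simp
  have "modular M \<Phi> (\<lambda>x. f x / of_real (unit_gauge * B)) \<le> modular M \<Phi> (\<lambda>x. 1 / of_real unit_gauge)"
    using assms unit_gauge(1)
    by (intro modular_mono) (simp add: norm_divide norm_mult divide_simps mult.commute)
  then show "modular M \<Phi> (\<lambda>x. f x / of_real (unit_gauge * B)) \<le> 1" using unit_gauge(2) by (rule order_trans)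
qed

lemma M\<Psi>_integrable:
  assumes "g \<in> M\<Psi>" shows "integrable M g"
  using holder_integrable(1)[OF continuous_M\<Phi> assms, of "\<lambda>_. 1"] by (simp add: continuous_on_const)

section \<open>Density of continuous functions in M^\<Phi>\<close>

lemma modular_add:
  assumes [measurable]: "a \<in> borel_measurable M" "b \<in> borel_measurable M"
    and k: "0 < k" "modular M \<Phi> (\<lambda>x. a x / of_real k) \<le> 1"
    and l: "0 < l" "modular M \<Phi> (\<lambda>x. b x / of_real l) \<le> 1"
  shows "modular M \<Phi> (\<lambda>x. (a x + b x) / of_real (k + l)) \<le> 1"
proof -
  \<comment> \<open>With weights \<open>k / (k + l)\<close> and \<open>l / (k + l)\<close> the
    quotient is a convex combination of \<open>a / k\<close> and \<open>b / l\<close>: the triangle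
    inequality in terms of gauges.\<close>
  define t where "t = l / (k + l)"
  have t: "0 \<le> t" "t \<le> 1" "1 - t = k / (k + l)" using k l by (auto simp: t_def field_simps)
  have "modular M \<Phi> (\<lambda>x. (a x + b x) / of_real (k + l))
      \<le> (\<integral>\<^sup>+x. ennreal (1 - t) * ennreal (\<Phi> (cmod (a x / of_real k))) + ennreal t * ennreal (\<Phi> (cmod (b x / of_real l))) \<partial>M)"
    unfolding modular_def
  proof (rule nn_integral_mono)
    fix x
    have "cmod ((a x + b x) / of_real (k + l)) = cmod (a x + b x) / (k + l)"
      using k l by (simp add: norm_divide del: of_real_add)
    also have "\<dots> \<le> (cmod (a x) + cmod (b x)) / (k + l)"
      using k l by (intro divide_right_mono norm_triangle_ineq) auto
    also have "\<dots> = (1 - t) * cmod (a x / of_real k) + t * cmod (b x / of_real l)"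
      using k l unfolding t(3) by (simp add: norm_divide add_divide_distrib t_def)
    finally have "\<Phi> (cmod ((a x + b x) / of_real (k + l))) \<le> \<Phi> ((1 - t) * cmod (a x / of_real k) + t * cmod (b x / of_real l))"
      by (intro \<Phi>_mono) auto
    also have "\<dots> \<le> (1 - t) * \<Phi> (cmod (a x / of_real k)) + t * \<Phi> (cmod (b x / of_real l))"
      using convex_onD[OF \<Phi>_convex t(1,2), of "cmod (a x / of_real k)" "cmod (b x / of_real l)"] by simp
    finally show "ennreal (\<Phi> (cmod ((a x + b x) / of_real (k + l))))
      \<le> ennreal (1 - t) * ennreal (\<Phi> (cmod (a x / of_real k))) + ennreal t * ennreal (\<Phi> (cmod (b x / of_real l)))"
      using t(1,2) by (simp add: ennreal_mult[symmetric] ennreal_plus[symmetric] ennreal_leI del: ennreal_plus of_real_add)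
  qed
  also have "\<dots> = ennreal (1 - t) * modular M \<Phi> (\<lambda>x. a x / of_real k) + ennreal t * modular M \<Phi> (\<lambda>x. b x / of_real l)"
    unfolding modular_def by (subst nn_integral_add) (auto simp: nn_integral_cmult)
  also have "\<dots> \<le> ennreal (1 - t) * 1 + ennreal t * 1"
    using k l by (intro add_mono mult_left_mono) auto
  also have "\<dots> = 1" using t by (simp add: ennreal_plus[symmetric] del: ennreal_plus)
  finally show ?thesis .
qed

text \<open>Closeness is measured by gauges rather than by \<open>nrm\<Phi>\<close>, so that
  \<open>modular_add\<close> applies directly to sums.\<close>

definition approximable :: "('g \<Rightarrow> complex) \<Rightarrow> bool" where
  "approximable f \<longleftrightarrow> (\<forall>k>0. \<exists>h. continuous_on UNIV h \<and> modular M \<Phi> (\<lambda>x. (f x - h x) / of_real k) \<le> 1)"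

lemma approximable_add:
  assumes [measurable]: "f \<in> borel_measurable M" "g \<in> borel_measurable M"
    and "approximable f" "approximable g"
  shows "approximable (\<lambda>x. f x + g x)"
  unfolding approximable_def
proof (intro allI impI)
  fix k :: real assume k: "0 < k"
  then obtain a b where a: "continuous_on UNIV a" "modular M \<Phi> (\<lambda>x. (f x - a x) / of_real (k/2)) \<le> 1"
    and b: "continuous_on UNIV b" "modular M \<Phi> (\<lambda>x. (g x - b x) / of_real (k/2)) \<le> 1"
    using assms(3,4) unfolding approximable_def by (meson half_gt_zero)
  note [measurable] = measurable_continuous[OF a(1)] measurable_continuous[OF b(1)]
  have "modular M \<Phi> (\<lambda>x. ((f x - a x) + (g x - b x)) / of_real (k/2 + k/2)) \<le> 1"
    using k a b by (intro modular_add) auto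
  then have "modular M \<Phi> (\<lambda>x. (f x + g x - (a x + b x)) / of_real k) \<le> 1"
    by (simp only: field_sum_of_halves add_diff_add)
  then show "\<exists>h. continuous_on UNIV h \<and> modular M \<Phi> (\<lambda>x. (f x + g x - h x) / of_real k) \<le> 1"
    using a b by (intro exI[of _ "\<lambda>x. a x + b x"]) (auto intro: continuous_on_add)
qed

lemma approximable_indicator:
  assumes "B \<in> sets borel"
  shows "approximable (\<lambda>x. c * indicator B x)"
  unfolding approximable_def
proof (intro allI impI)
  fix k :: real assume k: "0 < k"
  \<comment> \<open>The error will be at most \<open>cmod c\<close>, on a set of measure at most
    \<open>1 / (r + 1)\<close>, so its modular at gauge \<open>k\<close> is at most
    \<open>r / (r + 1)\<close>.\<close>
  define r where "r = \<Phi> (cmod c / k)"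
  have r: "0 \<le> r" by (simp add: r_def)
  then have "0 < 1 / (r + 1)" by simp
  from continuous_approx_indicator[OF assms this] obtain h :: "'g \<Rightarrow> real" and E
    where h: "continuous_on UNIV h" "\<And>x. 0 \<le> h x" "\<And>x. h x \<le> 1" "E \<in> sets borel"
      "emeasure M E \<le> ennreal (1 / (r + 1))" "\<And>x. x \<notin> E \<Longrightarrow> h x = indicator B x" by blast
  have "modular M \<Phi> (\<lambda>x. (c * indicator B x - c * of_real (h x)) / of_real k) \<le> (\<integral>\<^sup>+x. ennreal r * indicator E x \<partial>M)"
    unfolding modular_def
  proof (rule nn_integral_mono)
    fix x
    have eq: "c * indicator B x - c * of_real (h x) = c * of_real (indicator B x - h x)"
      by (simp add: algebra_simps indicator_def)
    show "ennreal (\<Phi> (cmod ((c * indicator B x - c * of_real (h x)) / of_real k))) \<le> ennreal r * indicator E x"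
    proof (cases "x \<in> E")
      case True
      have "\<bar>indicator B x - h x\<bar> \<le> 1" using h(2,3)[of x] by (auto simp: indicator_def)
      then have "cmod (c * of_real (indicator B x - h x)) \<le> cmod c"
        unfolding norm_mult norm_of_real by (intro mult_right_le_one_le) auto
      then have "\<Phi> (cmod ((c * of_real (indicator B x - h x)) / of_real k)) \<le> r"
        unfolding r_def using k by (intro \<Phi>_mono) (auto simp: norm_divide intro: divide_right_mono)
      then show ?thesis using True unfolding eq by (simp add: ennreal_leI)
    next
      case False
      then show ?thesis using h(6)[OF False] unfolding eq by simp
    qed
  qed
  also have "\<dots> = ennreal r * emeasure M E" using h(4) by (simp add: nn_integral_cmult_indicator)
  also have "\<dots> \<le> ennreal r * ennreal (1 / (r + 1))" using h by (intro mult_left_mono) auto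
  also have "\<dots> \<le> 1" using r by (simp add: ennreal_mult[symmetric] ennreal_le_1)
  finally show "\<exists>h. continuous_on UNIV h \<and> modular M \<Phi> (\<lambda>x. (c * indicator B x - h x) / of_real k) \<le> 1"
    using h(1) by (intro exI[of _ "\<lambda>x. c * of_real (h x)"]) (auto intro!: continuous_intros)
qed

lemma approximable_simple:
  fixes s :: "'g \<Rightarrow> complex"
  assumes s: "simple_function M s"
  shows "approximable s"
proof -
  have B: "s -` {y} \<in> sets borel" for y
    using simple_functionD(2)[OF s, of "{y}"] by simp
  have sums: "approximable (\<lambda>x. \<Sum>y\<in>I. y * indicator (s -` {y}) x)" if "finite I" for I
    using that
  proof induction
    case empty
    show ?case unfolding approximable_def
      by (auto intro!: exI[of _ "\<lambda>_. 0"] simp: modular_def)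
  next
    case (insert y I)
    have "approximable (\<lambda>x. y * indicator (s -` {y}) x + (\<Sum>y\<in>I. y * indicator (s -` {y}) x))"
    proof (intro approximable_add approximable_indicator B)
      have [measurable]: "s -` {y} \<in> sets M" for y using B by simp
      show "(\<lambda>x. y * indicator (s -` {y}) x) \<in> borel_measurable M" by measurable
      show "(\<lambda>x. \<Sum>y\<in>I. y * indicator (s -` {y}) x) \<in> borel_measurable M" by measurable
    qed (rule insert.IH)
    then show ?case by (simp only: sum.insert[OF insert.hyps])
  qed
  have fin: "finite (range s)" using simple_functionD(1)[OF s] by simp
  have "s x = (\<Sum>y\<in>range s. y * indicator (s -` {y}) x)" for x
  proof -
    have "(\<Sum>y\<in>range s. y * indicator (s -` {y}) x) = (\<Sum>y\<in>range s. if y = s x then y else 0)"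
      by (rule sum.cong) (auto simp: indicator_def)
    then show ?thesis using fin by simp
  qed
  then have "s = (\<lambda>x. \<Sum>y\<in>range s. y * indicator (s -` {y}) x)" by blast
  then show ?thesis using sums[OF fin] by metis
qed

text \<open>Dominated convergence for simple functions bounded by twice \<open>f\<close>. The
  majorant, \<open>\<Phi>\<close> of \<open>6 / k\<close> times \<open>cmod (f x)\<close>, is
  integrable because M^\<Phi> demands a finite modular at every scale. The 6 combines a factor 3
  from \<open>f x - s i x\<close> with the 2 from the gauge \<open>k / 2\<close>.\<close>

lemma approximable_M\<Phi>:
  assumes f: "f \<in> M\<Phi>"
  shows "approximable f"
  unfolding approximable_def
proof (intro allI impI)
  fix k :: real assume k: "0 < k"
  note [measurable] = M\<Phi>_measurable[OF f]
  obtain s where s: "\<And>i::nat. simple_function M (s i)" "\<And>x. (\<lambda>i. s i x) \<longlonglongrightarrow> f x"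
    "\<And>i x. cmod (s i x) \<le> 2 * cmod (f x)"
    using borel_measurable_implies_sequence_metric[OF M\<Phi>_measurable[OF f], of 0] by auto
  have [measurable]: "s i \<in> borel_measurable M" for i
    using borel_measurable_simple_function[OF s(1)] .
  have "(\<lambda>i. \<integral>\<^sup>+x. ennreal (\<Phi> (cmod ((f x - s i x) / of_real (k/2)))) \<partial>M) \<longlonglongrightarrow> (\<integral>\<^sup>+x. 0 \<partial>M)"
  proof (rule nn_integral_dominated_convergence[where w = "\<lambda>x. ennreal (\<Phi> (cmod (of_real (6 / k) * f x)))"])
    show "(\<integral>\<^sup>+x. ennreal (\<Phi> (cmod (of_real (6 / k) * f x))) \<partial>M) < \<infinity>"
      using f k unfolding M_space_def modular_def by (simp del: of_real_divide of_real_mult)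
    show "AE x in M. ennreal (\<Phi> (cmod ((f x - s i x) / of_real (k/2)))) \<le> ennreal (\<Phi> (cmod (of_real (6 / k) * f x)))" for i
    proof (intro AE_I2 ennreal_leI \<Phi>_mono)
      fix x
      have "cmod (f x - s i x) \<le> 3 * cmod (f x)" using norm_triangle_ineq4[of "f x" "s i x"] s(3)[of i x] by linarith
      then show "cmod ((f x - s i x) / of_real (k/2)) \<le> cmod (of_real (6 / k) * f x)"
        using k by (simp add: norm_divide norm_mult field_simps del: of_real_divide)
    qed simp
    have "(\<lambda>i. \<Phi> (cmod ((f x - s i x) / of_real (k/2)))) \<longlonglongrightarrow> \<Phi> (cmod ((f x - f x) / of_real (k/2)))" for x
      using k by (intro continuous_on_tendsto_compose[OF \<Phi>_continuous] tendsto_intros s(2)) auto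
    then have "(\<lambda>i. \<Phi> (cmod ((f x - s i x) / of_real (k/2)))) \<longlonglongrightarrow> 0" for x by simp
    then show "AE x in M. (\<lambda>i. ennreal (\<Phi> (cmod ((f x - s i x) / of_real (k/2))))) \<longlonglongrightarrow> 0"
      by (intro AE_I2) (metis ennreal_0 tendsto_ennrealI)
  qed measurable
  then have "(\<lambda>i. modular M \<Phi> (\<lambda>x. (f x - s i x) / of_real (k/2))) \<longlonglongrightarrow> 0" by (simp add: modular_def)
  then have "eventually (\<lambda>i. modular M \<Phi> (\<lambda>x. (f x - s i x) / of_real (k/2)) < 1) sequentially"
    by (rule order_tendstoD(2)) simp
  then obtain i where i: "modular M \<Phi> (\<lambda>x. (f x - s i x) / of_real (k/2)) \<le> 1"
    by (auto simp: eventually_sequentially intro: less_imp_le)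
  obtain h where h: "continuous_on UNIV h" "modular M \<Phi> (\<lambda>x. (s i x - h x) / of_real (k/2)) \<le> 1"
    using approximable_simple[OF s(1), of i] k unfolding approximable_def by (meson half_gt_zero)
  note [measurable] = measurable_continuous[OF h(1)]
  have "modular M \<Phi> (\<lambda>x. ((f x - s i x) + (s i x - h x)) / of_real (k/2 + k/2)) \<le> 1"
    using k i h by (intro modular_add) auto
  then show "\<exists>h. continuous_on UNIV h \<and> modular M \<Phi> (\<lambda>x. (f x - h x) / of_real k) \<le> 1"
    using h(1) by (intro exI[of _ h]) (simp only: field_sum_of_halves diff_add_cancel add_diff_eq simp_thms)
qed

lemma M\<Phi>_add:
  assumes "f \<in> M\<Phi>" "g \<in> M\<Phi>"
  shows "(\<lambda>x. f x + g x) \<in> M\<Phi>"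
proof -
  note [measurable] = M\<Phi>_measurable[OF assms(1)] M\<Phi>_measurable[OF assms(2)]
  have "modular M \<Phi> (\<lambda>x. complex_of_real a * (f x + g x)) < \<infinity>" if a: "0 < a" for a
  proof -
    have "modular M \<Phi> (\<lambda>x. complex_of_real a * (f x + g x))
      \<le> (\<integral>\<^sup>+x. ennreal (\<Phi> (cmod (of_real (2 * a) * f x))) + ennreal (\<Phi> (cmod (of_real (2 * a) * g x))) \<partial>M)"
      unfolding modular_def
    proof (rule nn_integral_mono)
      fix x
      \<comment> \<open>Bounding the sum by twice the maximum makes the resulting value of
        \<open>\<Phi>\<close> one of the two summands at scale \<open>2 * a\<close>.\<close>
      define m where "m = max (cmod (f x)) (cmod (g x))"
      have "cmod (complex_of_real a * (f x + g x)) \<le> (2 * a) * m"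
        using a norm_triangle_ineq[of "f x" "g x"] by (auto simp: norm_mult m_def)
      then have "\<Phi> (cmod (complex_of_real a * (f x + g x))) \<le> \<Phi> ((2 * a) * m)" by (intro \<Phi>_mono) auto
      also have "\<dots> \<le> \<Phi> (cmod (of_real (2 * a) * f x)) + \<Phi> (cmod (of_real (2 * a) * g x))"
        using a by (auto simp: m_def max_def norm_mult)
      finally show "ennreal (\<Phi> (cmod (complex_of_real a * (f x + g x))))
        \<le> ennreal (\<Phi> (cmod (of_real (2 * a) * f x))) + ennreal (\<Phi> (cmod (of_real (2 * a) * g x)))"
        by (simp add: ennreal_plus[symmetric] ennreal_leI del: ennreal_plus)
    qed
    also have "\<dots> = modular M \<Phi> (\<lambda>x. of_real (2 * a) * f x) + modular M \<Phi> (\<lambda>x. of_real (2 * a) * g x)"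
      unfolding modular_def by (rule nn_integral_add) measurable
    also have "\<dots> < \<infinity>"
      using assms a by (simp add: M_space_def del: of_real_mult)
    finally show ?thesis .
  qed
  then show ?thesis by (simp add: M_space_def)
qed

lemma M\<Phi>_cmult:
  assumes "f \<in> M\<Phi>"
  shows "(\<lambda>x. c * f x) \<in> M\<Phi>"
proof -
  note [measurable] = M\<Phi>_measurable[OF assms(1)]
  have "modular M \<Phi> (\<lambda>x. complex_of_real a * (c * f x)) < \<infinity>" if a: "0 < a" for a
  proof -
    \<comment> \<open>The added 1 keeps the scale positive for \<open>c = 0\<close>, since
      membership in M^\<Phi> speaks of positive scales only.\<close>
    have "modular M \<Phi> (\<lambda>x. complex_of_real a * (c * f x)) \<le> modular M \<Phi> (\<lambda>x. of_real (a * (cmod c + 1)) * f x)"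
      using a by (intro modular_mono)
        (auto simp: norm_mult mult.assoc simp del: of_real_add intro!: mult_left_mono mult_right_mono)
    also have "\<dots> < \<infinity>"
      using assms a by (simp add: M_space_def add_nonneg_pos del: of_real_mult)
    finally show ?thesis .
  qed
  then show ?thesis by (simp add: M_space_def)
qed

lemma M\<Phi>_diff: "f \<in> M\<Phi> \<Longrightarrow> g \<in> M\<Phi> \<Longrightarrow> (\<lambda>x. f x - g x) \<in> M\<Phi>"
  using M\<Phi>_add[of f "\<lambda>x. (-1) * g x"] M\<Phi>_cmult[of g "-1"] by simp

lemma continuous_dense:
  assumes "f \<in> M\<Phi>" "0 < e"
  obtains h where "continuous_on UNIV h" "nrm\<Phi> (\<lambda>x. f x - h x) \<le> ennreal e"
proof -
  obtain h where "continuous_on UNIV h" "modular M \<Phi> (\<lambda>x. (f x - h x) / of_real e) \<le> 1"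
    using approximable_M\<Phi>[OF assms(1)] assms(2) unfolding approximable_def by meson
  then show ?thesis using that[of h] lux_le[OF assms(2), of "\<lambda>x. f x - h x"] by simp
qed

end

section \<open>The space $A_\Phi(G)$ as a convolution algebra\<close>

text \<open>Below \<open>N\<close> there are \<open>(N + 1) div 2\<close> even and
  \<open>N div 2\<close> odd indices. This serves to merge two representations when elements of
  A_\<Phi>(G) are added.\<close>

lemma sum_interleave:
  fixes a b :: "nat \<Rightarrow> 'a::comm_monoid_add"
  shows "(\<Sum>n<N. if even n then a (n div 2) else b (n div 2))
    = (\<Sum>n<(N + 1) div 2. a n) + (\<Sum>n<N div 2. b n)"
proof (induction N)
  case (Suc N)
  show ?case
  proof (cases "even N")
    case True
    then have "(Suc N + 1) div 2 = Suc (N div 2)" "(N + 1) div 2 = N div 2" "Suc N div 2 = N div 2" by auto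
    then show ?thesis using Suc True by (simp add: ac_simps)
  next
    case False
    then have "(Suc N + 1) div 2 = (N + 1) div 2" "Suc N div 2 = Suc (N div 2)" by (auto elim: oddE)
    then show ?thesis using Suc False by (simp add: ac_simps)
  qed
qed simp

section \<open>Convolutions of M^\<Phi> with M^\<Psi>\<close>

context orlicz
begin

abbreviation "A \<equiv> A_space M \<Phi>"
abbreviation "nrmA \<equiv> A_norm M \<Phi>"
abbreviation "weight f g \<equiv> (\<Sum>n. nrm\<Phi> (f n) * nrm\<Psi> (g n))"

text \<open>The substitution \<open>y = x + w\<close> makes the value at \<open>x\<close> a pairing
  of a translate of \<open>f\<close> with the fixed function \<open>g\<close>, to which Hoelder's
  inequality applies.\<close>

lemma convolution_check:
  assumes [measurable]: "f \<in> borel_measurable M" "g \<in> borel_measurable M"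
  shows "convolution M f (check g) x = (\<integral>w. f (x + w) * g w \<partial>M)"
proof -
  have "(\<integral>y. f y * g (- x + y) \<partial>M) = (\<integral>w. f (x + w) * g (- x + (x + w)) \<partial>M)"
    by (rule integral_translation[symmetric, of "\<lambda>y. f y * g (- x + y)"]) measurable
  then show ?thesis by (simp add: convolution_def check_def)
qed

lemma
  assumes f: "f \<in> M\<Phi>" and g: "g \<in> M\<Psi>"
  shows convolution_integrable: "integrable M (\<lambda>w. f (x + w) * g w)"
    and convolution_bound: "cmod (convolution M f (check g) x) \<le> enn2real (nrm\<Phi> f * nrm\<Psi> g)"
  using holder_integrable[OF translation(1)[OF f] g, of x] translation(2)[OF f]
    convolution_check[OF M\<Phi>_measurable[OF f] M\<Psi>_measurable[OF g]] by auto

lemma convolution_add: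
  assumes "a \<in> M\<Phi>" "b \<in> M\<Phi>" "g \<in> M\<Psi>"
  shows "convolution M (\<lambda>x. a x + b x) (check g) = (\<lambda>x. convolution M a (check g) x + convolution M b (check g) x)"
  using assms by (simp add: convolution_check M\<Phi>_measurable M\<Psi>_measurable M\<Phi>_add distrib_right convolution_integrable fun_eq_iff)

lemma convolution_cmult:
  "convolution M (\<lambda>x. c * a x) g = (\<lambda>x. c * convolution M a g x)"
  by (simp add: convolution_def mult.assoc)

lemma convolution_diff:
  assumes "a \<in> M\<Phi>" "b \<in> M\<Phi>" "g \<in> M\<Psi>"
  shows "convolution M (\<lambda>x. a x - b x) (check g) = (\<lambda>x. convolution M a (check g) x - convolution M b (check g) x)"
  using assms by (simp add: convolution_check M\<Phi>_measurable M\<Psi>_measurable M\<Phi>_diff left_diff_distrib convolution_integrable fun_eq_iff)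

text \<open>The factor \<open>c\<close> stands for a dual norm and is left general, because
  \<open>convolution_twist\<close> asks for one \<open>h\<close> that is good for two second factors
  at once.\<close>

lemma convolution_dense:
  assumes f: "f \<in> M\<Phi>" and e: "0 < e" and c: "c < \<infinity>"
  obtains h where "continuous_on UNIV h" "enn2real (nrm\<Phi> (\<lambda>x. f x - h x) * c) \<le> e"
proof -
  obtain r where r: "0 \<le> r" "c = ennreal r" using c by (auto simp: less_top_ennreal)
  have "0 < e / (r + 1)" using r e by simp
  from continuous_dense[OF f this] obtain h where h: "continuous_on UNIV h" "nrm\<Phi> (\<lambda>x. f x - h x) \<le> ennreal (e / (r + 1))" .
  have "nrm\<Phi> (\<lambda>x. f x - h x) * c \<le> ennreal (e / (r + 1)) * ennreal r" using h r by (auto intro: mult_right_mono)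
  also have "\<dots> \<le> ennreal e"
    using r e by (subst ennreal_mult[symmetric]) (auto intro!: ennreal_leI simp: divide_simps mult.commute)
  finally have "enn2real (nrm\<Phi> (\<lambda>x. f x - h x) * c) \<le> e" using e by (intro enn2real_leI) auto
  then show ?thesis using that h by blast
qed

lemma continuous_limit:
  fixes u :: "'g \<Rightarrow> complex"
  assumes "\<And>e. 0 < e \<Longrightarrow> \<exists>h. continuous_on UNIV h \<and> (\<forall>x. cmod (u x - h x) \<le> e)"
  shows "continuous_on UNIV u"
proof -
  have "\<exists>h. continuous_on UNIV h \<and> (\<forall>x. cmod (u x - h x) \<le> 1 / real (Suc n))" for n
    by (rule assms) simp
  then obtain h where h: "\<And>n. continuous_on UNIV (h n)" "\<And>n x. cmod (u x - h n x) \<le> 1 / real (Suc n)"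
    by metis
  have "uniform_limit UNIV h u sequentially"
    unfolding uniform_limit_iff
  proof (intro allI impI)
    fix e :: real assume "0 < e"
    then have "eventually (\<lambda>n. 1 / real (Suc n) < e) sequentially"
      using order_tendstoD(2)[OF LIMSEQ_inverse_real_of_nat] by (simp add: inverse_eq_divide)
    then show "\<forall>\<^sub>F n in sequentially. \<forall>x\<in>UNIV. dist (h n x) (u x) < e"
      using h(2) by (auto simp: dist_norm norm_minus_commute elim!: eventually_mono intro: le_less_trans)
  qed
  then show ?thesis
    by (rule uniform_limit_theorem[rotated]) (simp_all add: h)
qed

lemma continuous_translate:
  fixes h :: "'g \<Rightarrow> complex"
  assumes "continuous_on UNIV h"
  shows "continuous_on UNIV (\<lambda>(y, x). h (y + x))" "continuous_on UNIV (\<lambda>(y, x). h (- y + x))"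
    "continuous_on UNIV (\<lambda>x. h (- y + x))"
  unfolding split_beta by (rule continuous_on_compose2[OF assms]; auto intro!: continuous_intros)+

text \<open>For continuous first factors this is a parameter integral. The passage to M^\<Phi> is
  uniform, since the bound in \<open>convolution_bound\<close> is independent of
  \<open>x\<close>.\<close>

lemma continuous_convolution_check:
  assumes f: "f \<in> M\<Phi>" and g: "g \<in> M\<Psi>"
  shows "continuous_on UNIV (convolution M f (check g))"
proof (rule continuous_limit)
  fix e :: real assume "0 < e"
  then obtain h where h: "continuous_on UNIV h" "enn2real (nrm\<Phi> (\<lambda>x. f x - h x) * nrm\<Psi> g) \<le> e"
    using convolution_dense[OF f _ dual_finite[OF g]] by blast
  have "continuous_on UNIV (convolution M h (check g))"
    using continuous_integral_param(1)[OF continuous_translate(1)[OF h(1)] M\<Psi>_integrable[OF g]]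
    by (simp add: convolution_check measurable_continuous h M\<Psi>_measurable g cong: continuous_on_cong)
  moreover have "cmod (convolution M f (check g) x - convolution M h (check g) x) \<le> e" for x
    using convolution_bound[OF M\<Phi>_diff[OF f continuous_M\<Phi>[OF h(1)]] g, of x] h(2)
    by (simp add: convolution_diff[OF f continuous_M\<Phi>[OF h(1)] g])
  ultimately show "\<exists>h. continuous_on UNIV h \<and> (\<forall>x. cmod (convolution M f (check g) x - h x) \<le> e)" by blast
qed

section \<open>Associativity, commutativity and the adjoint of convolution\<close>

lemma convolution_continuous_bound:
  assumes v: "\<And>x. cmod (v x) \<le> B" and w: "\<And>x. cmod (w x) \<le> C"
  shows "cmod (convolution M v w x) \<le> vol * (B * C)"
proof -
  have B: "0 \<le> B" using order_trans[OF norm_ge_zero v] .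
  show ?thesis unfolding convolution_def
    by (rule norm_integral_le) (auto simp: norm_mult intro!: mult_mono v w B)
qed

lemma convolution_integrable_continuous:
  fixes v w :: "'g \<Rightarrow> complex"
  assumes "continuous_on UNIV v" "continuous_on UNIV w"
  shows "integrable M (\<lambda>y. v y * w (- y + x))"
  by (intro integrable_continuous continuous_on_mult assms(1) continuous_on_compose2[OF assms(2)])
    (auto intro!: continuous_intros)

lemma continuous_convolution_kernel:
  fixes k h :: "'g \<Rightarrow> complex"
  assumes "continuous_on UNIV k" "continuous_on UNIV h"
  shows "continuous_on UNIV (\<lambda>(y, x). k y * h (- y + x))"
  unfolding split_beta
  by (intro continuous_on_mult continuous_on_compose2[OF assms(1)] continuous_on_compose2[OF assms(2)])
    (auto intro!: continuous_intros)

lemma continuous_convolution: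
  assumes k: "continuous_on UNIV k" and h: "continuous_on UNIV h"
  shows "continuous_on UNIV (convolution M k h)"
proof -
  have "continuous_on UNIV (\<lambda>(x, y). k y * h (- y + x))"
    using continuous_on_compose2[OF continuous_convolution_kernel[OF k h] continuous_on_swap, of UNIV]
    by (simp add: split_beta prod.swap_def)
  from continuous_integral_param(1)[OF this, of "\<lambda>_. 1"] show ?thesis
    by (simp add: convolution_def cong: continuous_on_cong)
qed

text \<open>Fubini for a continuous kernel in \<open>y\<close> and \<open>w\<close>, with
  \<open>g\<close> as the integrable factor.\<close>

lemma convolution_assoc:
  assumes k: "continuous_on UNIV k" and h: "continuous_on UNIV h" and g: "integrable M g"
  shows "convolution M k (convolution M h (check g)) = convolution M (convolution M k h) (check g)"
proof
  fix x
  note [measurable] = measurable_continuous[OF h] measurable_continuous[OF continuous_convolution[OF k h]]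
  have [measurable]: "g \<in> borel_measurable M" using g by auto
  have c: "continuous_on UNIV (\<lambda>(y, w). k y * h (- y + x + w))"
    unfolding split_beta
    by (intro continuous_on_mult continuous_on_compose2[OF k] continuous_on_compose2[OF h])
      (auto intro!: continuous_intros)
  have "convolution M k (convolution M h (check g)) x = (\<integral>y. (\<integral>w. k y * h (- y + x + w) * g w \<partial>M) \<partial>M)"
    unfolding convolution_def[of M k] by (subst convolution_check) (auto simp: mult.assoc)
  also have "\<dots> = (\<integral>w. (\<integral>y. k y * h (- y + x + w) \<partial>M) * g w \<partial>M)"
    by (rule fubini_continuous[OF c g])
  also have "\<dots> = convolution M (convolution M k h) (check g) x"
    unfolding convolution_check[OF measurable_continuous[OF continuous_convolution[OF k h]]
        \<open>g \<in> borel_measurable M\<close>]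
    by (simp add: convolution_def algebra_simps)
  finally show "convolution M k (convolution M h (check g)) x = convolution M (convolution M k h) (check g) x" .
qed

text \<open>Translation of the variable by \<open>x\<close>, then invariance of the integral under
  inversion.\<close>

lemma convolution_commute:
  assumes k: "continuous_on UNIV k" and h: "continuous_on UNIV h"
  shows "convolution M k h = convolution M h k"
proof
  fix x
  have c: "continuous_on UNIV (\<lambda>y. k (x + y) * h (- y))"
    by (intro continuous_on_mult continuous_on_compose2[OF k] continuous_on_compose2[OF h])
      (auto intro!: continuous_intros)
  have c': "continuous_on UNIV (\<lambda>y. k y * h (- y + x))"
    using continuous_on_curried(2)[OF continuous_convolution_kernel[OF k h]] .
  have "convolution M k h x = (\<integral>y. k (x + y) * h (- (x + y) + x) \<partial>M)"
    unfolding convolution_def using integral_translation[OF measurable_continuous[OF c'], of x] by simp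
  also have "\<dots> = (\<integral>y. k (x + y) * h (- y) \<partial>M)" by simp
  also have "\<dots> = (\<integral>y. k (x + - y) * h (- (- y)) \<partial>M)" using integral_inversion[OF c] by simp
  also have "\<dots> = convolution M h k x" by (simp add: convolution_def mult.commute)
  finally show "convolution M k h x = convolution M h k x" .
qed

text \<open>The adjoint of convolution by \<open>v\<close>: it is the convolution of
  \<open>g\<close> with \<open>check v\<close>, and \<open>check (twist v g)\<close> is
  \<open>convolution M v (check g)\<close>. Moving \<open>v\<close> onto the second factor leaves
  the first factor of a product untouched.\<close>

definition twist :: "('g \<Rightarrow> complex) \<Rightarrow> ('g \<Rightarrow> complex) \<Rightarrow> 'g \<Rightarrow> complex" where
  "twist v g = (\<lambda>t. \<integral>s. v (- t + s) * g s \<partial>M)"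

lemma continuous_twist:
  assumes "continuous_on UNIV v" "integrable M g"
  shows "continuous_on UNIV (twist v g)"
  unfolding twist_def by (rule continuous_integral_param(1)[OF continuous_translate(2)[OF assms(1)] assms(2)])

text \<open>Both sides equal \<open>convolution M (convolution M f v) (check g)\<close>: the right
  one by Fubini, the left one by associativity and commutativity.\<close>

lemma convolution_twist_continuous:
  assumes v: "continuous_on UNIV v" and f: "continuous_on UNIV f" and g: "integrable M g"
  shows "convolution M v (convolution M f (check g)) = convolution M f (check (twist v g))"
proof -
  note [measurable] = measurable_continuous[OF f] measurable_continuous[OF v]
    measurable_continuous[OF continuous_convolution[OF f v]] measurable_continuous[OF continuous_twist[OF v g]]
  have [measurable]: "g \<in> borel_measurable M" using g by auto
  have "convolution M f (check (twist v g)) x = convolution M (convolution M f v) (check g) x" for x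
  proof -
    have c: "continuous_on UNIV (\<lambda>(w, s). f (x + w) * v (- w + s))"
      unfolding split_beta
      by (intro continuous_on_mult continuous_on_compose2[OF f] continuous_on_compose2[OF v])
        (auto intro!: continuous_intros)
    have c': "(\<lambda>z. f z * v (- z + (x + s))) \<in> borel_measurable M" for s
      by (rule measurable_continuous[OF continuous_on_curried(2)[OF continuous_convolution_kernel[OF f v]]])
    have shift: "(\<integral>w. f (x + w) * v (- w + s) \<partial>M) = convolution M f v (x + s)" for s
      unfolding convolution_def using integral_translation[OF c', of x s] by (simp add: algebra_simps)
    have "convolution M f (check (twist v g)) x = (\<integral>w. (\<integral>s. f (x + w) * v (- w + s) * g s \<partial>M) \<partial>M)"
      unfolding convolution_check[OF measurable_continuous[OF f] measurable_continuous[OF continuous_twist[OF v g]]]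
      by (simp add: twist_def mult.assoc)
    also have "\<dots> = (\<integral>s. (\<integral>w. f (x + w) * v (- w + s) \<partial>M) * g s \<partial>M)"
      by (rule fubini_continuous[OF c g])
    also have "\<dots> = convolution M (convolution M f v) (check g) x"
      unfolding shift by (subst convolution_check) auto
    finally show ?thesis .
  qed
  then show ?thesis by (simp add: convolution_assoc[OF v f g] convolution_commute[OF v f] fun_eq_iff)
qed

text \<open>Density extends the continuous case, so that Fubini is never applied to a discontinuous
  \<open>f\<close>.\<close>

lemma convolution_twist:
  assumes v: "continuous_on UNIV v" and f: "f \<in> M\<Phi>" and g: "g \<in> M\<Psi>"
  shows "convolution M v (convolution M f (check g)) = convolution M f (check (twist v g))" (is "?l = ?r")
proof
  fix x
  note gi = M\<Psi>_integrable[OF g]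
  have t: "twist v g \<in> M\<Psi>" by (rule continuous_M\<Psi>[OF continuous_twist[OF v gi]])
  obtain B where B: "0 < B" "\<And>x. cmod (v x) \<le> B" using continuous_bounded[OF v] by blast
  have "cmod (?l x - ?r x) \<le> 0 + e" if e: "0 < e" for e
  proof -
    \<comment> \<open>The left side contributes \<open>vol * B * d\<close> to the error and the
      right side \<open>d\<close>.\<close>
    define d where "d = e / (vol * B + 1)"
    have d: "0 < d" unfolding d_def using e vol_pos B by (auto intro!: divide_pos_pos add_pos_pos)
    \<comment> \<open>Approximating against the sum of the two dual norms controls both sides with
      the same \<open>h\<close>.\<close>
    have "nrm\<Psi> g + nrm\<Psi> (twist v g) < \<infinity>" using dual_finite[OF g] dual_finite[OF t] by simp
    from convolution_dense[OF f d this] obtain h where h: "continuous_on UNIV h"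
      "enn2real (nrm\<Phi> (\<lambda>x. f x - h x) * (nrm\<Psi> g + nrm\<Psi> (twist v g))) \<le> d" .
    note hM = continuous_M\<Phi>[OF h(1)]
    have fin: "nrm\<Phi> (\<lambda>x. f x - h x) * (nrm\<Psi> g + nrm\<Psi> (twist v g)) < \<infinity>"
      using lux_finite[OF M\<Phi>_diff[OF f hM]] dual_finite[OF g] dual_finite[OF t] by (simp add: ennreal_mult_less_top)
    have "enn2real (nrm\<Phi> (\<lambda>x. f x - h x) * nrm\<Psi> g) \<le> d" "enn2real (nrm\<Phi> (\<lambda>x. f x - h x) * nrm\<Psi> (twist v g)) \<le> d"
      by (rule order_trans[OF enn2real_mono h(2)]; use fin in \<open>auto intro!: mult_left_mono\<close>)+
    then have 1: "cmod (convolution M f (check g) x - convolution M h (check g) x) \<le> d"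
      and 2: "cmod (?r x - convolution M h (check (twist v g)) x) \<le> d" for x
      using convolution_bound[OF M\<Phi>_diff[OF f hM] g, of x] convolution_bound[OF M\<Phi>_diff[OF f hM] t, of x]
      by (auto simp: convolution_diff[OF f hM g] convolution_diff[OF f hM t])
    have "?l x - convolution M v (convolution M h (check g)) x
        = convolution M v (\<lambda>x. convolution M f (check g) x - convolution M h (check g) x) x"
      unfolding convolution_def[of M v] right_diff_distrib
      by (intro Bochner_Integration.integral_diff[symmetric] convolution_integrable_continuous v
          continuous_convolution_check f g hM)
    then have 3: "cmod (?l x - convolution M v (convolution M h (check g)) x) \<le> vol * (B * d)"
      using convolution_continuous_bound[of v B, OF B(2) 1] by simp
    have "cmod (?l x - ?r x) \<le> vol * (B * d) + d"
      using 3 2[of x] norm_triangle_ineq4[of "?l x - convolution M v (convolution M h (check g)) x"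
          "?r x - convolution M h (check (twist v g)) x"]
      by (simp add: convolution_twist_continuous[OF v h(1) gi])
    also have "\<dots> = (vol * B + 1) * d" by (simp add: algebra_simps)
    also have "\<dots> = e" unfolding d_def using vol_pos B by (simp add: add_pos_pos less_imp_neq[symmetric])
    finally show ?thesis by simp
  qed
  then have "cmod (?l x - ?r x) \<le> 0" by (rule field_le_epsilon)
  then show "?l x = ?r x" by simp
qed

lemma dual_bounded:
  assumes B: "0 \<le> B" "\<And>x. cmod (h x) \<le> B"
  shows "nrm\<Psi> h \<le> ennreal B * nrm\<Psi> (\<lambda>_. 1)"
  unfolding dual_orlicz_norm_def[of M \<Phi> h]
proof (rule SUP_least)
  fix f assume f: "f \<in> {f \<in> borel_measurable M. nrm\<Phi> f \<le> 1}"
  then have [measurable]: "f \<in> borel_measurable M" by simp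
  have "(\<integral>\<^sup>+x. ennreal (cmod (f x * h x)) \<partial>M) \<le> (\<integral>\<^sup>+x. ennreal B * ennreal (cmod (f x * 1)) \<partial>M)"
    using B by (intro nn_integral_mono)
      (auto simp: ennreal_mult[symmetric] norm_mult mult.commute[of B] intro!: ennreal_leI mult_left_mono)
  also have "\<dots> = ennreal B * (\<integral>\<^sup>+x. ennreal (cmod (f x * 1)) \<partial>M)"
    by (rule nn_integral_cmult) measurable
  also have "\<dots> \<le> ennreal B * nrm\<Psi> (\<lambda>_. 1)"
    unfolding dual_orlicz_norm_def using f by (intro mult_left_mono SUP_upper) auto
  finally show "(\<integral>\<^sup>+x. ennreal (cmod (f x * h x)) \<partial>M) \<le> ennreal B * nrm\<Psi> (\<lambda>_. 1)" .
qed

text \<open>\<open>twist v g\<close> is bounded by \<open>B\<close> times the L^1 norm of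
  \<open>g\<close>, and Hoelder's inequality against the constant 1 bounds that norm by
  \<open>unit_gauge * nrm\<Psi> g\<close>.\<close>

lemma twist_dual_norm:
  assumes v: "continuous_on UNIV v" and B: "0 < B" "\<And>x. cmod (v x) \<le> B" and g: "g \<in> M\<Psi>"
  shows "nrm\<Psi> (twist v g) \<le> (ennreal (B * unit_gauge) * nrm\<Psi> (\<lambda>_. 1)) * nrm\<Psi> g"
proof -
  note [measurable] = M\<Psi>_measurable[OF g]
  obtain r where r: "0 \<le> r" "nrm\<Psi> g = ennreal r" using dual_finite[OF g] by (auto simp: less_top_ennreal)
  have "(\<integral>\<^sup>+x. ennreal (cmod (1 * g x)) \<partial>M) \<le> ennreal unit_gauge * nrm\<Psi> g"
    using unit_gauge by (intro holder_gauge) auto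
  then have "ennreal (\<integral>x. cmod (g x) \<partial>M) \<le> ennreal (unit_gauge * r)"
    using r unit_gauge(1) M\<Psi>_integrable[OF g] by (simp add: nn_integral_eq_integral ennreal_mult)
  then have L1: "(\<integral>x. cmod (g x) \<partial>M) \<le> unit_gauge * r"
    using r unit_gauge(1) by (simp add: ennreal_le_iff)
  have "cmod (twist v g t) \<le> B * (unit_gauge * r)" for t
  proof -
    have "cmod (twist v g t) \<le> (\<integral>s. cmod (v (- t + s) * g s) \<partial>M)"
      unfolding twist_def by (rule integral_norm_bound)
    also have "\<dots> \<le> (\<integral>s. B * cmod (g s) \<partial>M)"
    proof (rule integral_mono)
      show "integrable M (\<lambda>s. cmod (v (- t + s) * g s))"
        by (intro integrable_norm continuous_integral_param(2)[OF continuous_translate(2)[OF v] M\<Psi>_integrable[OF g]])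
    qed (use B M\<Psi>_integrable[OF g] in \<open>auto simp: norm_mult intro!: mult_right_mono\<close>)
    also have "\<dots> \<le> B * (unit_gauge * r)" using L1 B by simp
    finally show ?thesis .
  qed
  then have "nrm\<Psi> (twist v g) \<le> ennreal (B * (unit_gauge * r)) * nrm\<Psi> (\<lambda>_. 1)"
    using B r unit_gauge(1) by (intro dual_bounded) auto
  also have "\<dots> = (ennreal (B * unit_gauge) * nrm\<Psi> (\<lambda>_. 1)) * nrm\<Psi> g"
    using B r unit_gauge(1) by (simp add: ennreal_mult ac_simps)
  finally show ?thesis .
qed

section \<open>Representations and the norm of A_\<Phi>(G)\<close>

lemma enn2real_partial_weight:
  assumes "\<And>n. f n \<in> M\<Phi>" "\<And>n. g n \<in> M\<Psi>"
  shows "enn2real (\<Sum>n<N. nrm\<Phi> (f n) * nrm\<Psi> (g n)) = (\<Sum>n<N. enn2real (nrm\<Phi> (f n) * nrm\<Psi> (g n)))"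
  using lux_finite[OF assms(1)] dual_finite[OF assms(2)]
  by (subst enn2real_sum) (auto simp: ennreal_mult_less_top)

text \<open>Partial sums are estimated termwise by \<open>convolution_bound\<close>, and the bound
  passes to the limit. It later gives the boundedness of the Fourier functionals.\<close>

lemma representation_bound:
  assumes "A_representation M \<Phi> f g u"
  shows "cmod (u x) \<le> enn2real (weight f g)"
proof -
  have fM: "\<And>n. f n \<in> M\<Phi>" and gM: "\<And>n. g n \<in> M\<Psi>" and fin: "weight f g < \<infinity>"
    and lim: "uniform_limit UNIV (\<lambda>N x. \<Sum>n<N. convolution M (f n) (check (g n)) x) u sequentially"
    using assms by (auto simp: A_representation_def)
  have "cmod (\<Sum>n<N. convolution M (f n) (check (g n)) x) \<le> enn2real (weight f g)" for N
  proof -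
    have "cmod (\<Sum>n<N. convolution M (f n) (check (g n)) x) \<le> (\<Sum>n<N. enn2real (nrm\<Phi> (f n) * nrm\<Psi> (g n)))"
      by (intro order_trans[OF norm_sum] sum_mono convolution_bound fM gM)
    also have "\<dots> = enn2real (\<Sum>n<N. nrm\<Phi> (f n) * nrm\<Psi> (g n))"
      by (rule enn2real_partial_weight[OF fM gM, symmetric])
    also have "\<dots> \<le> enn2real (weight f g)"
      using fin by (intro enn2real_mono sum_le_suminf) auto
    finally show ?thesis .
  qed
  moreover have "(\<lambda>N. \<Sum>n<N. convolution M (f n) (check (g n)) x) \<longlonglongrightarrow> u x"
    using tendsto_uniform_limitI[OF lim] by simp
  ultimately show ?thesis
    by (intro tendsto_upperbound[OF tendsto_norm]) (auto intro: always_eventually)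
qed

lemma representation_continuous:
  assumes "A_representation M \<Phi> f g u"
  shows "continuous_on UNIV u"
proof (rule uniform_limit_theorem)
  show "uniform_limit UNIV (\<lambda>N x. \<Sum>n<N. convolution M (f n) (check (g n)) x) u sequentially"
    using assms by (simp add: A_representation_def)
  show "\<forall>\<^sub>F N in sequentially. continuous_on UNIV (\<lambda>x. \<Sum>n<N. convolution M (f n) (check (g n)) x)"
    using assms unfolding A_representation_def
    by (intro always_eventually allI continuous_on_sum continuous_convolution_check) auto
qed simp

lemma A_iff: "u \<in> A \<longleftrightarrow> (\<exists>f g. A_representation M \<Phi> f g u)"
proof -
  have "u \<in> C0" if "A_representation M \<Phi> f g u" for f g
  proof -
    note c = representation_continuous[OF that]
    have "compact {x. \<epsilon> \<le> cmod (u x)}" for \<epsilon>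
    proof -
      have "closed {x. \<epsilon> \<le> cmod (u x)}" by (intro closed_Collect_le continuous_intros c)
      then show ?thesis using compact_Int_closed[OF compact_UNIV] by simp
    qed
    then show ?thesis using c by (simp add: C0_def)
  qed
  then show ?thesis unfolding A_space_def by blast
qed

lemma A_continuous: "u \<in> A \<Longrightarrow> continuous_on UNIV u"
  using representation_continuous by (auto simp: A_iff)

lemma A_norm_le:
  assumes "A_representation M \<Phi> f g u"
  shows "nrmA u \<le> enn2real (weight f g)"
  unfolding A_norm_def
proof (rule enn2real_mono)
  show "(INF (f, g)\<in>{(f, g). A_representation M \<Phi> f g u}. weight f g) \<le> weight f g"
    using assms by (intro INF_lower2[of "(f, g)"]) auto
  show "weight f g < top" using assms by (simp add: A_representation_def)
qed

text \<open>\<open>A_norm\<close> is made real by \<open>enn2real\<close>, which sends \<infinity>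
  to 0. A lower bound therefore requires a finite infimum, and this is what \<open>u \<in> A\<close>
  provides.\<close>

lemma A_norm_ge:
  assumes u: "u \<in> A" and c: "0 \<le> c" "\<And>f g. A_representation M \<Phi> f g u \<Longrightarrow> c \<le> enn2real (weight f g)"
  shows "c \<le> nrmA u"
proof -
  obtain f0 g0 where r: "A_representation M \<Phi> f0 g0 u" using u by (auto simp: A_iff)
  define I where "I = (INF (f, g)\<in>{(f, g). A_representation M \<Phi> f g u}. weight f g)"
  have "I \<le> weight f0 g0" unfolding I_def using r by (intro INF_lower2[of "(f0, g0)"]) auto
  also have "\<dots> < top" using r by (simp add: A_representation_def)
  finally have fin: "I < top" .
  have "ennreal c \<le> I"
    unfolding I_def
  proof (rule INF_greatest, clarify)
    fix f g assume r: "A_representation M \<Phi> f g u"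
    then have "weight f g < top" by (simp add: A_representation_def)
    then show "ennreal c \<le> weight f g" using ennreal_leI[OF c(2)[OF r]] by simp
  qed
  then have "enn2real (ennreal c) \<le> enn2real I" using fin by (rule enn2real_mono)
  then show ?thesis using c(1) by (simp add: A_norm_def I_def)
qed

lemma dual_zero: "nrm\<Psi> (\<lambda>_. 0) = 0"
  using dual_bounded[of 0 "\<lambda>_. 0"] by simp

text \<open>Only the second factors are set to 0 after index 0, so the weight is exactly one product
  and no norm of a zero first factor occurs.\<close>

lemma representation_single:
  assumes f: "f \<in> M\<Phi>" and g: "g \<in> M\<Psi>"
  defines "G \<equiv> \<lambda>n::nat. if n = 0 then g else (\<lambda>_. 0)"
  shows "A_representation M \<Phi> (\<lambda>_. f) G (convolution M f (check g))"
    and "weight (\<lambda>_. f) G = nrm\<Phi> f * nrm\<Psi> g"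
proof -
  have w: "(\<lambda>n. nrm\<Phi> f * nrm\<Psi> (G n)) = (\<lambda>n. if n = 0 then nrm\<Phi> f * nrm\<Psi> g else 0)"
    by (auto simp: G_def dual_zero)
  show W: "weight (\<lambda>_. f) G = nrm\<Phi> f * nrm\<Psi> g"
    unfolding w using sums_unique[OF sums_single[of 0 "\<lambda>_. nrm\<Phi> f * nrm\<Psi> g"]] by simp
  have 0: "(\<lambda>_. 0) \<in> M\<Psi>" by (rule continuous_M\<Psi>) (rule continuous_on_const)
  have s: "(\<Sum>n<N. convolution M f (check (G n)) x) = convolution M f (check g) x" if "1 \<le> N" for N x
  proof -
    have "convolution M f (check (G n)) x = (if n = 0 then convolution M f (check g) x else 0)" for n
      by (simp add: G_def convolution_def check_def)
    then show ?thesis using that by simp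
  qed
  have "uniform_limit UNIV (\<lambda>N x. \<Sum>n<N. convolution M f (check (G n)) x) (convolution M f (check g)) sequentially"
    unfolding uniform_limit_iff
  proof (intro allI impI)
    fix e :: real assume "0 < e"
    then show "\<forall>\<^sub>F N in sequentially. \<forall>x\<in>UNIV. dist (\<Sum>n<N. convolution M f (check (G n)) x) (convolution M f (check g) x) < e"
      using s by (intro eventually_sequentiallyI[of 1]) auto
  qed
  then show "A_representation M \<Phi> (\<lambda>_. f) G (convolution M f (check g))"
    unfolding A_representation_def W using f g 0 lux_finite[OF f] dual_finite[OF g]
    by (auto simp: G_def ennreal_mult_less_top)
qed

lemma convolution_in_A: "f \<in> M\<Phi> \<Longrightarrow> g \<in> M\<Psi> \<Longrightarrow> convolution M f (check g) \<in> A"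
  using representation_single(1) A_iff by blast

section \<open>Closure of A_\<Phi>(G) under sums, convolutions and scalar multiples\<close>

lemma A_add:
  assumes "u \<in> A" "v \<in> A"
  shows "(\<lambda>x. u x + v x) \<in> A"
proof -
  obtain f g f' g' where r: "A_representation M \<Phi> f g u" "A_representation M \<Phi> f' g' v"
    using assms by (auto simp: A_iff)
  \<comment> \<open>Even indices carry the first representation and odd indices the second, so that
    partial sums split as in \<open>sum_interleave\<close>.\<close>
  define F where "F = (\<lambda>n. if even n then f (n div 2) else f' (n div 2))"
  define G where "G = (\<lambda>n. if even n then g (n div 2) else g' (n div 2))"
  have "(\<Sum>n<N. nrm\<Phi> (F n) * nrm\<Psi> (G n)) \<le> weight f g + weight f' g'" for N
  proof -
    have "(\<Sum>n<N. nrm\<Phi> (F n) * nrm\<Psi> (G n)) = (\<Sum>n<N. if even n then nrm\<Phi> (f (n div 2)) * nrm\<Psi> (g (n div 2))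
        else nrm\<Phi> (f' (n div 2)) * nrm\<Psi> (g' (n div 2)))"
      by (rule sum.cong) (auto simp: F_def G_def)
    also have "\<dots> \<le> weight f g + weight f' g'"
      unfolding sum_interleave[of "\<lambda>n. nrm\<Phi> (f n) * nrm\<Psi> (g n)" "\<lambda>n. nrm\<Phi> (f' n) * nrm\<Psi> (g' n)"]
      by (intro add_mono sum_le_suminf) auto
    finally show ?thesis .
  qed
  then have "weight F G \<le> weight f g + weight f' g'" by (intro suminf_le_const) auto
  also have "\<dots> < \<infinity>" using r by (simp add: A_representation_def)
  finally have W: "weight F G < \<infinity>" .
  define s where "s = (\<lambda>N x. \<Sum>n<N. convolution M (f n) (check (g n)) x)"
  define s' where "s' = (\<lambda>N x. \<Sum>n<N. convolution M (f' n) (check (g' n)) x)"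
  have lim: "uniform_limit UNIV s u sequentially" "uniform_limit UNIV s' v sequentially"
    using r by (auto simp: A_representation_def s_def s'_def)
  have "filterlim (\<lambda>N::nat. (N + 1) div 2) at_top sequentially" "filterlim (\<lambda>N::nat. N div 2) at_top sequentially"
    unfolding filterlim_at_top
    by (intro allI, rule_tac c = "2 * Z" in eventually_sequentiallyI, simp)+
  then have "uniform_limit UNIV (\<lambda>N x. s ((N + 1) div 2) x + s' (N div 2) x) (\<lambda>x. u x + v x) sequentially"
    using lim by (intro uniform_limit_add) (rule filterlim_compose; assumption)+
  moreover have "(\<lambda>N x. s ((N + 1) div 2) x + s' (N div 2) x) = (\<lambda>N x. \<Sum>n<N. convolution M (F n) (check (G n)) x)"
  proof (intro ext)
    fix N x
    have "(\<Sum>n<N. convolution M (F n) (check (G n)) x)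
      = (\<Sum>n<N. if even n then convolution M (f (n div 2)) (check (g (n div 2))) x
          else convolution M (f' (n div 2)) (check (g' (n div 2))) x)"
      by (rule sum.cong) (auto simp: F_def G_def)
    then show "s ((N + 1) div 2) x + s' (N div 2) x = (\<Sum>n<N. convolution M (F n) (check (G n)) x)"
      unfolding sum_interleave[of "\<lambda>n. convolution M (f n) (check (g n)) x" "\<lambda>n. convolution M (f' n) (check (g' n)) x"]
      by (simp add: s_def s'_def)
  qed
  ultimately have "A_representation M \<Phi> F G (\<lambda>x. u x + v x)"
    using r W by (auto simp: A_representation_def F_def G_def)
  then show ?thesis by (auto simp: A_iff)
qed

text \<open>Convolution by \<open>v\<close> is moved into every second factor by
  \<open>twist\<close>, at the cost of one constant \<open>K\<close> in the weight. As
  \<open>v\<close> is just continuous, A_\<Phi>(G) is an ideal in C(G).\<close>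

lemma A_convolution:
  assumes v: "continuous_on UNIV v" and u: "u \<in> A"
  shows "convolution M v u \<in> A"
proof -
  obtain f g where r: "A_representation M \<Phi> f g u" using u by (auto simp: A_iff)
  then have fM: "\<And>n. f n \<in> M\<Phi>" and gM: "\<And>n. g n \<in> M\<Psi>" and fin: "weight f g < \<infinity>"
    and lim: "uniform_limit UNIV (\<lambda>N x. \<Sum>n<N. convolution M (f n) (check (g n)) x) u sequentially"
    by (auto simp: A_representation_def)
  obtain B where B: "0 < B" "\<And>x. cmod (v x) \<le> B" using continuous_bounded[OF v] by blast
  have t: "twist v (g n) \<in> M\<Psi>" for n by (rule continuous_M\<Psi>[OF continuous_twist[OF v M\<Psi>_integrable[OF gM]]])
  define K where "K = ennreal (B * unit_gauge) * nrm\<Psi> (\<lambda>_. 1)"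
  have K: "K < \<infinity>" unfolding K_def
    using dual_finite[OF continuous_M\<Psi>[OF continuous_on_const]] by (simp add: ennreal_mult_less_top)
  have "weight f (\<lambda>n. twist v (g n)) \<le> (\<Sum>n. K * (nrm\<Phi> (f n) * nrm\<Psi> (g n)))"
  proof (rule suminf_le)
    show "nrm\<Phi> (f n) * nrm\<Psi> (twist v (g n)) \<le> K * (nrm\<Phi> (f n) * nrm\<Psi> (g n))" for n
      using mult_left_mono[OF twist_dual_norm[OF v B gM, of n], of "nrm\<Phi> (f n)"] by (simp add: K_def ac_simps)
  qed auto
  also have "\<dots> = K * weight f g" by simp
  also have "\<dots> < \<infinity>" using K fin by (simp add: ennreal_mult_less_top)
  finally have W: "weight f (\<lambda>n. twist v (g n)) < \<infinity>" .
  have sum: "(\<Sum>n<N. convolution M (f n) (check (twist v (g n))) x)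
    = convolution M v (\<lambda>x. \<Sum>n<N. convolution M (f n) (check (g n)) x) x" for N x
    unfolding convolution_twist[OF v fM gM, symmetric] convolution_def[of M v] sum_distrib_left
    by (intro Bochner_Integration.integral_sum[symmetric] convolution_integrable_continuous v
        continuous_convolution_check fM gM)
  have "uniform_limit UNIV (\<lambda>N x. \<Sum>n<N. convolution M (f n) (check (twist v (g n))) x) (convolution M v u) sequentially"
    unfolding uniform_limit_iff
  proof (intro allI impI)
    fix e :: real assume e: "0 < e"
    \<comment> \<open>Convolution by \<open>v\<close> enlarges a uniform error by at most
      \<open>vol * B\<close>; the 2 makes the estimate strict.\<close>
    define d where "d = e / (2 * (vol * B))"
    have d: "0 < d" using e vol_pos B by (simp add: d_def)
    have "\<forall>\<^sub>F N in sequentially. \<forall>x\<in>UNIV. dist (\<Sum>n<N. convolution M (f n) (check (g n)) x) (u x) < d"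
      using lim d unfolding uniform_limit_iff by blast
    then show "\<forall>\<^sub>F N in sequentially. \<forall>x\<in>UNIV. dist (\<Sum>n<N. convolution M (f n) (check (twist v (g n))) x) (convolution M v u x) < e"
    proof eventually_elim
      case (elim N)
      define s where "s = (\<lambda>x. \<Sum>n<N. convolution M (f n) (check (g n)) x)"
      have cs: "continuous_on UNIV s" unfolding s_def
        by (intro continuous_on_sum continuous_convolution_check fM gM)
      have "convolution M v s x - convolution M v u x = convolution M v (\<lambda>x. s x - u x) x" for x
        unfolding convolution_def right_diff_distrib
        by (intro Bochner_Integration.integral_diff[symmetric] convolution_integrable_continuous v cs A_continuous u)
      moreover have "cmod (convolution M v (\<lambda>x. s x - u x) x) \<le> vol * (B * d)" for x
        using elim by (intro convolution_continuous_bound B) (auto simp: s_def dist_norm intro: less_imp_le)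
      moreover have "vol * (B * d) < e" using vol_pos B e by (simp add: d_def)
      ultimately show ?case unfolding sum s_def[symmetric] by (auto simp: dist_norm intro: le_less_trans)
    qed
  qed
  then have "A_representation M \<Phi> f (\<lambda>n. twist v (g n)) (convolution M v u)"
    using fM t W by (simp add: A_representation_def)
  then show ?thesis by (auto simp: A_iff)
qed

text \<open>Stated with a positive upper bound \<open>r\<close> of \<open>cmod c\<close>, so that
  division by \<open>r\<close> covers \<open>c = 0\<close> as well.\<close>

lemma lux_cmult_le:
  assumes c: "cmod c \<le> r" "0 < r" and f: "f \<in> M\<Phi>"
  shows "nrm\<Phi> (\<lambda>x. c * f x) \<le> ennreal r * nrm\<Phi> f"
proof -
  have "nrm\<Phi> (\<lambda>x. c * f x) / ennreal r \<le> nrm\<Phi> f"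
    unfolding luxemburg_norm_def[of M \<Phi> f]
  proof (rule INF_greatest)
    fix k assume "k \<in> {k. 0 < k \<and> modular M \<Phi> (\<lambda>x. f x / complex_of_real k) \<le> 1}"
    then have k: "0 < k" "modular M \<Phi> (\<lambda>x. f x / of_real k) \<le> 1" by auto
    have "modular M \<Phi> (\<lambda>x. c * f x / of_real (r * k)) \<le> modular M \<Phi> (\<lambda>x. f x / of_real k)"
    proof (rule modular_mono)
      fix x
      have "cmod c * cmod (f x) \<le> r * cmod (f x)" using c by (intro mult_right_mono) auto
      then show "cmod (c * f x / of_real (r * k)) \<le> cmod (f x / of_real k)"
        using c k by (simp add: norm_divide norm_mult field_simps)
    qed
    then have "nrm\<Phi> (\<lambda>x. c * f x) \<le> ennreal (r * k)" using c k by (intro lux_le) (auto intro: order_trans)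
    then have "nrm\<Phi> (\<lambda>x. c * f x) / ennreal r \<le> ennreal (r * k) / ennreal r" by (rule divide_right_mono_ennreal)
    also have "\<dots> = ennreal k" using c k by (simp add: divide_ennreal)
    finally show "nrm\<Phi> (\<lambda>x. c * f x) / ennreal r \<le> ennreal k" .
  qed
  then have "ennreal r * (nrm\<Phi> (\<lambda>x. c * f x) / ennreal r) \<le> ennreal r * nrm\<Phi> f" by (intro mult_left_mono) auto
  moreover have "ennreal r * (nrm\<Phi> (\<lambda>x. c * f x) / ennreal r) = nrm\<Phi> (\<lambda>x. c * f x)"
    using ennreal_mult_divide_eq[of "ennreal r" "nrm\<Phi> (\<lambda>x. c * f x)"] c
    by (simp add: ennreal_times_divide mult.commute)
  ultimately show ?thesis by simp
qed

lemma A_cmult: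
  assumes "u \<in> A"
  shows "(\<lambda>x. c * u x) \<in> A"
proof -
  obtain f g where r: "A_representation M \<Phi> f g u" using assms by (auto simp: A_iff)
  have "weight (\<lambda>n x. c * f n x) g \<le> (\<Sum>n. ennreal (cmod c + 1) * (nrm\<Phi> (f n) * nrm\<Psi> (g n)))"
  proof (rule suminf_le)
    fix n
    have "nrm\<Phi> (\<lambda>x. c * f n x) \<le> ennreal (cmod c + 1) * nrm\<Phi> (f n)"
      using r by (intro lux_cmult_le) (auto simp: A_representation_def add_nonneg_pos)
    from mult_right_mono[OF this, of "nrm\<Psi> (g n)"]
    show "nrm\<Phi> (\<lambda>x. c * f n x) * nrm\<Psi> (g n) \<le> ennreal (cmod c + 1) * (nrm\<Phi> (f n) * nrm\<Psi> (g n))"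
      by (simp add: mult.assoc del: ennreal_plus)
  qed auto
  also have "\<dots> = ennreal (cmod c + 1) * weight f g" by simp
  also have "\<dots> < \<infinity>" using r by (simp add: A_representation_def ennreal_mult_less_top)
  finally have W: "weight (\<lambda>n x. c * f n x) g < \<infinity>" .
  have "uniform_limit UNIV (\<lambda>N x. c * (\<Sum>n<N. convolution M (f n) (check (g n)) x)) (\<lambda>x. c * u x) sequentially"
    using r by (intro bounded_linear_uniform_limit_intros) (auto simp: A_representation_def)
  then have "A_representation M \<Phi> (\<lambda>n x. c * f n x) g (\<lambda>x. c * u x)"
    using r W by (simp add: A_representation_def M\<Phi>_cmult convolution_cmult sum_distrib_left)
  then show ?thesis by (auto simp: A_iff)
qed

end

section \<open>Characters\<close>

text \<open>If \<open>cmod (\<theta> x)\<close> exceeded 1, its powers, which are moduli of values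
  of \<open>\<theta>\<close>, would be unbounded. The bound at \<open>- x\<close> gives the reverse
  inequality.\<close>

lemma unimodular_homomorphism:
  fixes \<theta> :: "'a::group_add \<Rightarrow> complex"
  assumes add: "\<And>x y. \<theta> (x + y) = \<theta> x * \<theta> y" and 0: "\<theta> 0 = 1" and bound: "\<And>x. cmod (\<theta> x) \<le> B"
  shows "cmod (\<theta> x) = 1"
proof -
  have le: "cmod (\<theta> x) \<le> 1" for x
  proof (rule ccontr)
    assume "\<not> cmod (\<theta> x) \<le> 1"
    then obtain n where "B < cmod (\<theta> x) ^ n" using real_arch_pow[of "cmod (\<theta> x)" B] by auto
    \<comment> \<open>The argument on the left is the n-fold sum of \<open>x\<close>.\<close>
    moreover have "\<theta> (((+) x ^^ n) 0) = \<theta> x ^ n" by (induction n) (auto simp: add 0)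
    ultimately show False using bound[of "((+) x ^^ n) 0"] by (simp add: norm_power)
  qed
  have "cmod (\<theta> x) * cmod (\<theta> (- x)) = 1" using add[of x "- x"] 0 by (simp add: norm_mult[symmetric])
  moreover have "cmod (\<theta> x) * cmod (\<theta> (- x)) \<le> cmod (\<theta> x) * 1" by (intro mult_left_mono le) auto
  ultimately show ?thesis using le[of x] by linarith
qed

lemma discrete_homeomorphic_space:
  assumes "bij_betw f U V"
  shows "discrete_topology U homeomorphic_space discrete_topology V"
proof -
  have "homeomorphic_maps (discrete_topology U) (discrete_topology V) f (the_inv_into U f)"
    using assms bij_betw_the_inv_into[OF assms]
    unfolding homeomorphic_maps_def
    by (auto simp: continuous_map_from_discrete_topology bij_betw_def the_inv_into_f_f f_the_inv_into_f)
  then show ?thesis unfolding homeomorphic_space_def by blast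
qed

section \<open>Orthogonality and discreteness of the dual group\<close>

context compact_haar
begin

lemma dual_groupD:
  assumes "\<xi> \<in> dual_group"
  shows "continuous_on UNIV \<xi>" "cmod (\<xi> x) = 1" "\<xi> (x + y) = \<xi> x * \<xi> y" "\<xi> x \<noteq> 0"
    "cnj (\<xi> x) * \<xi> x = 1" "\<xi> 0 = 1" "\<xi> (- x) = cnj (\<xi> x)"
proof -
  have *: "continuous_on UNIV \<xi>" "cmod (\<xi> x) = 1" "\<xi> (x + y) = \<xi> x * \<xi> y" for x y
    using assms by (auto simp: dual_group_def)
  show "continuous_on UNIV \<xi>" "cmod (\<xi> x) = 1" "\<xi> (x + y) = \<xi> x * \<xi> y" using * by auto
  show nz: "\<xi> x \<noteq> 0" for x using *(2)[of x] by auto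
  show u: "cnj (\<xi> x) * \<xi> x = 1" for x using *(2)[of x] by (simp add: complex_norm_square[symmetric] mult.commute)
  show 0: "\<xi> 0 = 1" using *(3)[of 0 0] nz[of 0] by simp
  have "\<xi> (- x) * \<xi> x = cnj (\<xi> x) * \<xi> x" using *(3)[of "- x" x] 0 u by simp
  then show "\<xi> (- x) = cnj (\<xi> x)" using nz by simp
qed

text \<open>Translating the variable by \<open>a\<close> multiplies the integral by
  \<open>\<xi> a * cnj (\<xi>' a)\<close>, which differs from 1 when
  \<open>\<xi> a \<noteq> \<xi>' a\<close>.\<close>

lemma orthogonality:
  assumes \<xi>: "\<xi> \<in> dual_group" and \<xi>': "\<xi>' \<in> dual_group"
  shows "(\<integral>x. \<xi> x * cnj (\<xi>' x) \<partial>M) = (if \<xi> = \<xi>' then of_real vol else 0)"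
proof (cases "\<xi> = \<xi>'")
  case True
  then show ?thesis using dual_groupD(5)[OF \<xi>'] by (simp add: vol_def scaleR_conv_of_real mult.commute)
next
  case False
  then obtain a where a: "\<xi> a \<noteq> \<xi>' a" by blast
  have c: "continuous_on UNIV (\<lambda>x. \<xi> x * cnj (\<xi>' x))"
    by (intro continuous_intros dual_groupD(1) assms)
  have "(\<integral>x. \<xi> x * cnj (\<xi>' x) \<partial>M) = (\<integral>x. \<xi> (a + x) * cnj (\<xi>' (a + x)) \<partial>M)"
    using integral_translation[OF measurable_continuous[OF c]] by simp
  also have "\<dots> = (\<integral>x. (\<xi> a * cnj (\<xi>' a)) * (\<xi> x * cnj (\<xi>' x)) \<partial>M)"
    by (simp add: dual_groupD(3)[OF \<xi>] dual_groupD(3)[OF \<xi>'] ac_simps)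
  also have "\<dots> = (\<xi> a * cnj (\<xi>' a)) * (\<integral>x. \<xi> x * cnj (\<xi>' x) \<partial>M)" by simp
  finally have "(\<integral>x. \<xi> x * cnj (\<xi>' x) \<partial>M) = 0 \<or> \<xi> a * cnj (\<xi>' a) = 1" by auto
  moreover have "\<xi> a * cnj (\<xi>' a) \<noteq> 1"
  proof
    assume "\<xi> a * cnj (\<xi>' a) = 1"
    then have "\<xi> a * (cnj (\<xi>' a) * \<xi>' a) = \<xi>' a" by (simp add: mult.assoc[symmetric])
    then show False using a dual_groupD(5)[OF \<xi>'] by simp
  qed
  ultimately show ?thesis using False by simp
qed

text \<open>For distinct characters the integral of
  \<open>(\<xi> x - \<xi>' x) * cnj (\<xi>' x)\<close> is \<open>- vol\<close> by orthogonality,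
  whereas closeness bounds its modulus by \<open>vol * (3 / 4)\<close>. The value 3/4 is what the
  covering of the circle by balls yields below.\<close>

lemma dual_group_close_eq:
  fixes \<xi> \<xi>' :: "'g \<Rightarrow> complex"
  assumes \<xi>: "\<xi> \<in> dual_group" and \<xi>': "\<xi>' \<in> dual_group" and close: "\<And>x. cmod (\<xi> x - \<xi>' x) \<le> 3 / 4"
  shows "\<xi> = \<xi>'"
proof (rule ccontr)
  assume "\<xi> \<noteq> \<xi>'"
  have i: "integrable M (\<lambda>x. \<xi> x * cnj (\<xi>' x))" "integrable M (\<lambda>x. \<xi>' x * cnj (\<xi>' x))"
    by (intro integrable_continuous continuous_intros dual_groupD(1) assms)+
  have "(\<integral>x. (\<xi> x - \<xi>' x) * cnj (\<xi>' x) \<partial>M) = - of_real vol"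
    using i \<open>\<xi> \<noteq> \<xi>'\<close> by (simp add: left_diff_distrib orthogonality assms)
  moreover have "cmod (\<integral>x. (\<xi> x - \<xi>' x) * cnj (\<xi>' x) \<partial>M) \<le> vol * (3 / 4)"
    by (rule norm_integral_le) (simp only: norm_mult complex_mod_cnj dual_groupD(2)[OF \<xi>'] mult_1_right close)
  ultimately show False using vol_pos by simp
qed

lemma dual_group_topology_discrete:
  "(dual_group_topology :: ('g \<Rightarrow> complex) topology) = discrete_topology dual_group"
proof -
  let ?S = "{{h :: 'g \<Rightarrow> complex. h ` K \<subseteq> U} | K U. compact K \<and> open U}"
  have basic: "openin compact_open_topology {h :: 'g \<Rightarrow> complex. h ` K \<subseteq> U}" if "compact K" "open U" for K U
    unfolding compact_open_topology_def using that by (intro topology_generated_by_Basis) blast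
  have "openin compact_open_topology {h :: 'g \<Rightarrow> complex. h ` {} \<subseteq> UNIV}" by (rule basic) auto
  then have top: "topspace (compact_open_topology :: ('g \<Rightarrow> complex) topology) = UNIV"
    using openin_subset by fastforce
  have "openin dual_group_topology {\<xi>}" if \<xi>: "\<xi> \<in> dual_group" for \<xi> :: "'g \<Rightarrow> complex"
  proof -
    have "sphere (0::complex) 1 \<subseteq> (\<Union>z\<in>sphere 0 1. ball z (1/4))" by auto
    then obtain T where T: "T \<subseteq> sphere (0::complex) 1" "finite T" "sphere 0 1 \<subseteq> (\<Union>z\<in>T. ball z (1/4))"
      using compactE_image[OF compact_sphere[of "0::complex" 1], of "sphere 0 1" "\<lambda>z. ball z (1/4)"] by auto
    have "\<xi> 0 \<in> sphere 0 1" using dual_groupD(2)[OF \<xi>] by simp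
    then have "T \<noteq> {}" using T(3) by auto
    \<comment> \<open>Subbasic sets of the compact-open topology prescribe one target per compact
      set, so closeness is imposed piecewise: where \<open>\<xi>\<close> is within 1/4 of
      \<open>z\<close>, \<open>h\<close> is within 1/2 of \<open>z\<close>, hence within 3/4 of
      \<open>\<xi>\<close>.\<close>
    define W where "W = (\<Inter>z\<in>T. {h :: 'g \<Rightarrow> complex. h ` (\<xi> -` cball z (1/4)) \<subseteq> ball z (1/2)})"
    have "compact (\<xi> -` cball z (1/4))" for z
      using compact_Int_closed[OF compact_UNIV, of "\<xi> -` cball z (1/4)"]
        continuous_closed_vimage[of "cball z (1/4)" \<xi>] dual_groupD(1)[OF \<xi>]
      by (simp add: continuous_on_eq_continuous_within)
    then have "openin compact_open_topology W"
      unfolding W_def using T(2) \<open>T \<noteq> {}\<close> by (intro openin_INT2 basic) auto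
    moreover have "W \<inter> dual_group = {\<xi>}"
    proof (intro equalityI subsetI)
      fix h assume h: "h \<in> W \<inter> dual_group"
      have "cmod (h x - \<xi> x) \<le> 3 / 4" for x
      proof -
        have "\<xi> x \<in> sphere 0 1" using dual_groupD(2)[OF \<xi>] by simp
        then obtain z where z: "z \<in> T" "\<xi> x \<in> ball z (1/4)" using T(3) by blast
        then have "h x \<in> ball z (1/2)" using h by (auto simp: W_def image_subset_iff less_imp_le)
        then show ?thesis using z(2) dist_triangle[of "h x" "\<xi> x" z] by (simp add: dist_norm norm_minus_commute)
      qed
      then show "h \<in> {\<xi>}" using dual_group_close_eq h \<xi> by blast
    next
      fix h assume "h \<in> {\<xi>}"
      then show "h \<in> W \<inter> dual_group" using \<xi> by (auto simp: W_def)
    qed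
    ultimately show ?thesis unfolding dual_group_topology_def openin_subtopology by metis
  qed
  moreover have "topspace (dual_group_topology :: ('g \<Rightarrow> complex) topology) = dual_group"
    by (simp add: dual_group_topology_def top)
  ultimately show ?thesis by (metis discrete_topology_unique)
qed

end

section \<open>Fourier functionals\<close>

context orlicz
begin

abbreviation "\<Delta> \<equiv> character_space A nrmA (convolution M)"

text \<open>The integral is not divided by \<open>vol\<close>: convolution uses the same
  unnormalised measure, and this choice makes the functional multiplicative.\<close>

definition fourier :: "('g \<Rightarrow> complex) \<Rightarrow> ('g \<Rightarrow> complex) \<Rightarrow> complex" where
  "fourier \<xi> = (\<lambda>u\<in>A. \<integral>x. u x * cnj (\<xi> x) \<partial>M)"

text \<open>Up to the factor \<open>vol\<close>, \<open>\<xi>\<close> is idempotent under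
  convolution, and it equals \<open>check (\<lambda>x. cnj (\<xi> x))\<close>, which puts the
  product into the form that A_\<Phi>(G) requires.\<close>

lemma dual_group_in_A:
  assumes \<xi>: "\<xi> \<in> dual_group"
  shows "\<xi> \<in> A"
proof -
  note D = dual_groupD[OF \<xi>]
  have cc: "continuous_on UNIV (\<lambda>x. cnj (\<xi> x))" by (intro continuous_intros D(1))
  have "\<xi> y * \<xi> (- y + x) = \<xi> x" for x y
    using D(3)[of y "- y + x"] by simp
  then have "convolution M \<xi> (check (\<lambda>x. cnj (\<xi> x))) = (\<lambda>x. of_real vol * \<xi> x)"
    by (simp add: convolution_def check_def D(7)[symmetric] vol_def scaleR_conv_of_real del: minus_add_distrib)
  then have "(\<lambda>x. of_real vol * \<xi> x) \<in> A"
    using convolution_in_A[OF continuous_M\<Phi>[OF D(1)] continuous_M\<Psi>[OF cc]] by simp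
  from A_cmult[OF this, of "1 / of_real vol"] show ?thesis using vol_pos by simp
qed

lemma fourier_dual_group:
  assumes "\<xi> \<in> dual_group" "\<xi>' \<in> dual_group"
  shows "fourier \<xi>' \<xi> = (if \<xi> = \<xi>' then of_real vol else 0)"
  using assms by (simp add: fourier_def dual_group_in_A orthogonality)

lemma fourier_convolution:
  assumes \<xi>: "\<xi> \<in> dual_group" and u: "continuous_on UNIV u" and v: "continuous_on UNIV v"
  shows "(\<integral>x. convolution M u v x * cnj (\<xi> x) \<partial>M) = (\<integral>x. u x * cnj (\<xi> x) \<partial>M) * (\<integral>x. v x * cnj (\<xi> x) \<partial>M)"
proof -
  note D = dual_groupD[OF \<xi>]
  have c: "integrable M (\<lambda>x. cnj (\<xi> x))" by (intro integrable_continuous continuous_intros D(1))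
  have cv: "continuous_on UNIV (\<lambda>x. v x * cnj (\<xi> x))" by (intro continuous_intros D(1) v)
  have "(\<integral>x. convolution M u v x * cnj (\<xi> x) \<partial>M) = (\<integral>x. (\<integral>y. u y * v (- y + x) \<partial>M) * cnj (\<xi> x) \<partial>M)"
    by (simp add: convolution_def)
  also have "\<dots> = (\<integral>y. (\<integral>x. u y * v (- y + x) * cnj (\<xi> x) \<partial>M) \<partial>M)"
    by (rule fubini_continuous[OF continuous_convolution_kernel[OF u v] c, symmetric])
  also have "\<dots> = (\<integral>y. u y * cnj (\<xi> y) * (\<integral>x. v x * cnj (\<xi> x) \<partial>M) \<partial>M)"
  proof (rule Bochner_Integration.integral_cong[OF refl])
    fix y
    \<comment> \<open>Splitting \<open>\<xi> x\<close> as \<open>\<xi> y * \<xi> (- y + x)\<close>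
      separates the variables after a translation.\<close>
    have "u y * v (- y + x) * cnj (\<xi> x) = u y * cnj (\<xi> y) * (v (- y + x) * cnj (\<xi> (- y + x)))" for x
      using D(3)[of y "- y + x"] by simp
    then have "(\<integral>x. u y * v (- y + x) * cnj (\<xi> x) \<partial>M)
        = (\<integral>x. u y * cnj (\<xi> y) * (v (- y + x) * cnj (\<xi> (- y + x))) \<partial>M)"
      by (simp only:)
    also have "\<dots> = u y * cnj (\<xi> y) * (\<integral>x. v x * cnj (\<xi> x) \<partial>M)"
      using integral_translation[OF measurable_continuous[OF cv], of "- y"] by simp
    finally show "(\<integral>x. u y * v (- y + x) * cnj (\<xi> x) \<partial>M) = u y * cnj (\<xi> y) * (\<integral>x. v x * cnj (\<xi> x) \<partial>M)" .
  qed
  also have "\<dots> = (\<integral>x. u x * cnj (\<xi> x) \<partial>M) * (\<integral>x. v x * cnj (\<xi> x) \<partial>M)" by simp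
  finally show ?thesis .
qed

lemma fourier_character:
  assumes \<xi>: "\<xi> \<in> dual_group"
  shows "fourier \<xi> \<in> \<Delta>"
proof -
  note D = dual_groupD[OF \<xi>]
  have int: "integrable M (\<lambda>x. u x * cnj (\<xi> x))" if "u \<in> A" for u
    using A_continuous[OF that] D(1) by (intro integrable_continuous continuous_intros)
  have bound: "cmod (fourier \<xi> u) \<le> vol * nrmA u" if u: "u \<in> A" for u
  proof -
    \<comment> \<open>\<open>A_norm_ge\<close> compares a constant with the norm, so the factor
      \<open>vol\<close> is divided out first.\<close>
    have "cmod (fourier \<xi> u) / vol \<le> nrmA u"
    proof (rule A_norm_ge[OF u])
      fix f g assume r: "A_representation M \<Phi> f g u"
      have "cmod (fourier \<xi> u) \<le> vol * enn2real (weight f g)"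
        using u representation_bound[OF r] D(2)
        by (simp add: fourier_def) (intro norm_integral_le, simp add: norm_mult)
      then show "cmod (fourier \<xi> u) / vol \<le> enn2real (weight f g)" using vol_pos by (simp add: divide_le_eq mult.commute)
    qed (use vol_pos in auto)
    then show ?thesis using vol_pos by (simp add: divide_le_eq mult.commute)
  qed
  show ?thesis
    unfolding character_space_def
  proof (intro CollectI conjI ballI allI)
    show "fourier \<xi> \<in> extensional A" by (simp add: fourier_def)
    show "fourier \<xi> (\<lambda>x. u x + v x) = fourier \<xi> u + fourier \<xi> v" if "u \<in> A" "v \<in> A" for u v
      using that A_add[OF that] int by (simp add: fourier_def distrib_right)
    show "fourier \<xi> (\<lambda>x. c * u x) = c * fourier \<xi> u" if "u \<in> A" for c u
      using that A_cmult[OF that] by (simp add: fourier_def mult.assoc)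
    show "fourier \<xi> (convolution M u v) = fourier \<xi> u * fourier \<xi> v" if "u \<in> A" "v \<in> A" for u v
      using that A_convolution[OF A_continuous[OF that(1)] that(2)] fourier_convolution[OF \<xi>] A_continuous
      by (simp add: fourier_def)
    show "\<exists>C. \<forall>u\<in>A. cmod (fourier \<xi> u) \<le> C * nrmA u" using bound by blast
    show "\<exists>u\<in>A. fourier \<xi> u \<noteq> 0"
      using dual_group_in_A[OF \<xi>] fourier_dual_group[OF \<xi> \<xi>] vol_pos by (intro bexI[of _ \<xi>]) auto
  qed
qed

lemma inj_fourier: "inj_on fourier dual_group"
proof (rule inj_onI)
  fix \<xi> \<xi>' :: "'g \<Rightarrow> complex"
  assume a: "\<xi> \<in> dual_group" "\<xi>' \<in> dual_group" "fourier \<xi> = fourier \<xi>'"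
  then have "fourier \<xi> \<xi> = fourier \<xi>' \<xi>" by simp
  then show "\<xi> = \<xi>'" using fourier_dual_group[OF a(1,1)] fourier_dual_group[OF a(1,2)] vol_pos
    by (auto split: if_splits)
qed

section \<open>Arbitrary characters\<close>

lemma characterD:
  assumes "\<phi> \<in> \<Delta>"
  shows "\<phi> \<in> extensional A"
    and "\<And>u v. u \<in> A \<Longrightarrow> v \<in> A \<Longrightarrow> \<phi> (\<lambda>x. u x + v x) = \<phi> u + \<phi> v"
    and "\<And>u c. u \<in> A \<Longrightarrow> \<phi> (\<lambda>x. c * u x) = c * \<phi> u"
    and "\<And>u v. u \<in> A \<Longrightarrow> v \<in> A \<Longrightarrow> \<phi> (convolution M u v) = \<phi> u * \<phi> v"
    and "\<exists>u\<in>A. \<phi> u \<noteq> 0"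
    and "\<exists>C\<ge>0. \<forall>u f g. A_representation M \<Phi> f g u \<longrightarrow> cmod (\<phi> u) \<le> C * enn2real (weight f g)"
proof -
  have "\<exists>C. \<forall>u\<in>A. cmod (\<phi> u) \<le> C * nrmA u"
    using assms by (simp add: character_space_def)
  then obtain C where C: "\<And>u. u \<in> A \<Longrightarrow> cmod (\<phi> u) \<le> C * nrmA u" by blast
  \<comment> \<open>Bounding by the weight of a given representation spares later estimates the
    infimum; \<open>\<bar>C\<bar>\<close> replaces a possibly negative \<open>C\<close>.\<close>
  have "cmod (\<phi> u) \<le> \<bar>C\<bar> * enn2real (weight f g)" if r: "A_representation M \<Phi> f g u" for u f g
  proof -
    have "cmod (\<phi> u) \<le> C * nrmA u" using r by (intro C) (auto simp: A_iff)
    also have "\<dots> \<le> \<bar>C\<bar> * nrmA u" by (intro mult_right_mono) (auto simp: A_norm_def)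
    also have "\<dots> \<le> \<bar>C\<bar> * enn2real (weight f g)" by (intro mult_left_mono A_norm_le r) auto
    finally show ?thesis .
  qed
  then show "\<exists>C\<ge>0. \<forall>u f g. A_representation M \<Phi> f g u \<longrightarrow> cmod (\<phi> u) \<le> C * enn2real (weight f g)"
    by (intro exI[of _ "\<bar>C\<bar>"]) auto
qed (use assms in \<open>auto simp: character_space_def\<close>)

text \<open>Otherwise density makes \<open>\<phi>\<close> vanish on all products, and then on
  A_\<Phi>(G). Uniform convergence of the series alone would not justify the last step, since
  \<open>\<phi>\<close> is bounded only in the norm of A_\<Phi>(G); the remainders are represented
  by the shifted sequences, whose weights tend to 0.\<close>

lemma character_nonzero_on_product:
  assumes \<phi>: "\<phi> \<in> \<Delta>"
  obtains h g where "continuous_on UNIV h" "g \<in> M\<Psi>" "\<phi> (convolution M h (check g)) \<noteq> 0"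
proof (rule ccontr)
  assume "\<not> thesis"
  then have zero: "\<And>h g. continuous_on UNIV h \<Longrightarrow> g \<in> M\<Psi> \<Longrightarrow> \<phi> (convolution M h (check g)) = 0"
    using that by blast
  note D = characterD[OF \<phi>]
  obtain C where C: "0 \<le> C" "\<And>u f g. A_representation M \<Phi> f g u \<Longrightarrow> cmod (\<phi> u) \<le> C * enn2real (weight f g)"
    using D(6) by blast
  have zero': "\<phi> (convolution M f (check g)) = 0" if f: "f \<in> M\<Phi>" and g: "g \<in> M\<Psi>" for f g
  proof -
    have "cmod (\<phi> (convolution M f (check g))) \<le> 0 + e" if e: "0 < e" for e
    proof -
      have "0 < e / (C + 1)" using e C(1) by simp
      from convolution_dense[OF f this dual_finite[OF g]] obtain h where h: "continuous_on UNIV h"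
        "enn2real (nrm\<Phi> (\<lambda>x. f x - h x) * nrm\<Psi> g) \<le> e / (C + 1)" .
      note hM = continuous_M\<Phi>[OF h(1)]
      note d = M\<Phi>_diff[OF f hM]
      have "\<phi> (\<lambda>x. convolution M (\<lambda>x. f x - h x) (check g) x + convolution M h (check g) x)
          = \<phi> (convolution M (\<lambda>x. f x - h x) (check g)) + \<phi> (convolution M h (check g))"
        by (intro D(2) convolution_in_A d g hM)
      then have "\<phi> (convolution M f (check g)) = \<phi> (convolution M (\<lambda>x. f x - h x) (check g))"
        by (simp add: convolution_diff[OF f hM g] zero[OF h(1) g])
      then have "cmod (\<phi> (convolution M f (check g))) \<le> C * enn2real (nrm\<Phi> (\<lambda>x. f x - h x) * nrm\<Psi> g)"
        using C(2)[OF representation_single(1)[OF d g]] representation_single(2)[OF d g] by simp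
      also have "\<dots> \<le> C * (e / (C + 1))" using h(2) C(1) by (intro mult_left_mono) auto
      also have "\<dots> \<le> e" using C(1) e by (simp add: field_simps)
      finally show ?thesis by simp
    qed
    then have "cmod (\<phi> (convolution M f (check g))) \<le> 0" by (rule field_le_epsilon)
    then show ?thesis by simp
  qed
  have "\<phi> u = 0" if u: "u \<in> A" for u
  proof -
    obtain f g where r: "A_representation M \<Phi> f g u" using u by (auto simp: A_iff)
    then have fM: "\<And>n. f n \<in> M\<Phi>" and gM: "\<And>n. g n \<in> M\<Psi>" and fin: "weight f g < \<infinity>"
      and lim: "uniform_limit UNIV (\<lambda>N x. \<Sum>n<N. convolution M (f n) (check (g n)) x) u sequentially"
      by (auto simp: A_representation_def)
    define R where "R = (\<lambda>N x. u x - (\<Sum>n<N. convolution M (f n) (check (g n)) x))"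
    have W: "weight f g = weight (\<lambda>n. f (n + N)) (\<lambda>n. g (n + N)) + (\<Sum>n<N. nrm\<Phi> (f n) * nrm\<Psi> (g n))" for N
      by (rule suminf_offset) auto
    have rep: "A_representation M \<Phi> (\<lambda>n. f (n + N)) (\<lambda>n. g (n + N)) (R N)" for N
    proof -
      have "weight (\<lambda>n. f (n + N)) (\<lambda>n. g (n + N)) < \<infinity>" using fin W[of N] by (auto simp: less_top[symmetric])
      moreover have "uniform_limit UNIV (\<lambda>K x. (\<Sum>n<K + N. convolution M (f n) (check (g n)) x)
          - (\<Sum>n<N. convolution M (f n) (check (g n)) x)) (R N) sequentially"
        unfolding R_def
        by (intro uniform_limit_minus uniform_limit_const filterlim_compose[OF lim filterlim_add_const_nat_at_top])
      moreover have "(\<Sum>n<K + N. convolution M (f n) (check (g n)) x) - (\<Sum>n<N. convolution M (f n) (check (g n)) x)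
        = (\<Sum>n<K. convolution M (f (n + N)) (check (g (n + N))) x)" for K x
        by (induction K) (auto simp: algebra_simps)
      ultimately show ?thesis using fM gM by (simp add: A_representation_def)
    qed
    have "\<phi> u = \<phi> (R N)" for N
    proof (induction N)
      case (Suc N)
      have "R N = (\<lambda>x. R (Suc N) x + convolution M (f N) (check (g N)) x)" by (auto simp: R_def)
      moreover have "\<phi> (\<lambda>x. R (Suc N) x + convolution M (f N) (check (g N)) x)
          = \<phi> (R (Suc N)) + \<phi> (convolution M (f N) (check (g N)))"
        using rep by (intro D(2) convolution_in_A fM gM) (auto simp: A_iff)
      ultimately show ?case using Suc zero'[OF fM gM] by simp
    qed (simp add: R_def)
    then have le: "cmod (\<phi> u) \<le> C * enn2real (weight (\<lambda>n. f (n + N)) (\<lambda>n. g (n + N)))" for N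
      using C(2)[OF rep] by metis
    \<comment> \<open>Finiteness of the total weight lets the tail be written as a difference of
      reals, whose limit is then immediate.\<close>
    have tail: "enn2real (weight (\<lambda>n. f (n + N)) (\<lambda>n. g (n + N)))
        = enn2real (weight f g) - enn2real (\<Sum>n<N. nrm\<Phi> (f n) * nrm\<Psi> (g n))" for N
    proof -
      have "enn2real (weight f g) = enn2real (weight (\<lambda>n. f (n + N)) (\<lambda>n. g (n + N)))
          + enn2real (\<Sum>n<N. nrm\<Phi> (f n) * nrm\<Psi> (g n))"
        using fin W[of N] by (subst W[of N], intro enn2real_plus) (auto simp: less_top[symmetric])
      then show ?thesis by simp
    qed
    have "(\<lambda>N. enn2real (\<Sum>n<N. nrm\<Phi> (f n) * nrm\<Psi> (g n))) \<longlonglongrightarrow> enn2real (weight f g)"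
    proof (rule tendsto_enn2real)
      show "(\<lambda>N. \<Sum>n<N. nrm\<Phi> (f n) * nrm\<Psi> (g n)) \<longlonglongrightarrow> ennreal (enn2real (weight f g))"
        using fin summable_LIMSEQ[OF summableI, of "\<lambda>n. nrm\<Phi> (f n) * nrm\<Psi> (g n)"] by simp
    qed simp
    then have "(\<lambda>N. C * (enn2real (weight f g) - enn2real (\<Sum>n<N. nrm\<Phi> (f n) * nrm\<Psi> (g n))))
        \<longlonglongrightarrow> C * (enn2real (weight f g) - enn2real (weight f g))"
      by (intro tendsto_mult tendsto_diff tendsto_const)
    then have "cmod (\<phi> u) \<le> 0" using le unfolding tail by (intro LIMSEQ_le_const) auto
    then show ?thesis by simp
  qed
  then show False using D(5) by blast
qed

lemma surj_fourier:
  assumes \<phi>: "\<phi> \<in> \<Delta>"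
  shows "\<phi> \<in> fourier ` dual_group"
proof -
  note D = characterD[OF \<phi>]
  obtain C where C: "0 \<le> C" "\<And>u f g. A_representation M \<Phi> f g u \<Longrightarrow> cmod (\<phi> u) \<le> C * enn2real (weight f g)"
    using D(6) by blast
  obtain h g where h: "continuous_on UNIV h" and g: "g \<in> M\<Psi>" and nz: "\<phi> (convolution M h (check g)) \<noteq> 0"
    using character_nonzero_on_product[OF \<phi>] by blast
  define F where "F = (\<lambda>a. \<phi> (convolution M a (check g)))"
  \<comment> \<open>\<open>C\<close> comes from \<open>\<phi>\<close>, \<open>unit_gauge\<close>
    from comparing the supremum norm with \<open>nrm\<Phi>\<close>, and the last factor from the
    fixed \<open>g\<close>.\<close>
  define K where "K = C * (unit_gauge * enn2real (nrm\<Psi> g))"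
  define L where "L = (\<lambda>y x. h (- y + x))"
  define \<theta> where "\<theta> = (\<lambda>y. F (L y) / F h)"
  have cL: "continuous_on UNIV (L y)" for y unfolding L_def by (rule continuous_translate(3)[OF h])
  have in_A: "convolution M a (check g) \<in> A" if "continuous_on UNIV a" for a
    by (intro convolution_in_A continuous_M\<Phi> that g)
  have F_add: "F (\<lambda>x. a x + b x) = F a + F b" if "continuous_on UNIV a" "continuous_on UNIV b" for a b
    unfolding F_def convolution_add[OF continuous_M\<Phi>[OF that(1)] continuous_M\<Phi>[OF that(2)] g]
    by (intro D(2) in_A that)
  have F_scale: "F (\<lambda>x. c * a x) = c * F a" if "continuous_on UNIV a" for c a
    unfolding F_def convolution_cmult by (intro D(3) in_A that)
  have F_bound: "cmod (F a) \<le> K * B" if a: "continuous_on UNIV a" "0 < B" "\<And>x. cmod (a x) \<le> B" for a B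
  proof -
    note aM = continuous_M\<Phi>[OF a(1)]
    have "enn2real (nrm\<Phi> a) \<le> unit_gauge * B"
      using lux_bounded[OF a(2,3)] unit_gauge(1) a(2) by (intro enn2real_leI) auto
    then have "enn2real (nrm\<Phi> a * nrm\<Psi> g) \<le> unit_gauge * B * enn2real (nrm\<Psi> g)"
      unfolding enn2real_mult by (intro mult_right_mono) auto
    moreover have "cmod (F a) \<le> C * enn2real (nrm\<Phi> a * nrm\<Psi> g)"
      using C(2)[OF representation_single(1)[OF aM g]] representation_single(2)[OF aM g] by (simp add: F_def)
    ultimately have "cmod (F a) \<le> C * (unit_gauge * B * enn2real (nrm\<Psi> g))"
      using C(1) by (meson mult_left_mono order_trans)
    then show ?thesis by (simp add: K_def ac_simps)
  qed
  have Fh: "F h \<noteq> 0" using nz by (simp add: F_def)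
  have L0: "L 0 = h" by (simp add: L_def)
  have hom: "\<theta> (x + y) = \<theta> x * \<theta> y" for x y
  proof -
    define u where "u = (\<lambda>y. convolution M (L y) (check g))"
    have uA: "u y \<in> A" for y unfolding u_def by (rule in_A[OF cL])
    \<comment> \<open>Convolution commutes with translation, so every \<open>u y\<close> is a
      translate of \<open>u 0\<close>.\<close>
    have u: "u y t = u 0 (- y + t)" for y t
      unfolding u_def convolution_check[OF measurable_continuous[OF cL] M\<Psi>_measurable[OF g]]
      by (simp add: L_def algebra_simps)
    have "convolution M (u x) (u y) = convolution M (u (x + y)) (u 0)"
    proof
      fix t
      have c: "continuous_on UNIV (\<lambda>s. u (x + y) s * u 0 (- s + t))"
        by (intro continuous_on_mult A_continuous[OF uA] continuous_on_compose2[OF A_continuous[OF uA]])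
          (auto intro!: continuous_intros)
      \<comment> \<open>Shifting the variable by \<open>y\<close> turns \<open>u (x + y)\<close>
        into \<open>u x\<close> and hands the translation by \<open>y\<close> over to
        \<open>u 0\<close>.\<close>
      have "convolution M (u (x + y)) (u 0) t = (\<integral>s. u (x + y) (y + s) * u 0 (- (y + s) + t) \<partial>M)"
        unfolding convolution_def using integral_translation[OF measurable_continuous[OF c], of y] by simp
      also have "\<dots> = (\<integral>s. u x s * u y (- s + t) \<partial>M)"
        unfolding u[of "x + y"] u[of x] u[of y] by (simp add: algebra_simps)
      finally show "convolution M (u x) (u y) t = convolution M (u (x + y)) (u 0) t"
        by (simp add: convolution_def)
    qed
    then have "\<phi> (u x) * \<phi> (u y) = \<phi> (u (x + y)) * \<phi> (u 0)"
      using D(4)[OF uA uA] by metis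
    then have "F (L x) * F (L y) = F (L (x + y)) * F h" by (simp add: F_def u_def L0)
    then show ?thesis using Fh by (simp add: \<theta>_def field_simps)
  qed
  \<comment> \<open>The translates of \<open>h\<close> vary continuously in the supremum norm, in
    which \<open>F\<close> is bounded.\<close>
  have \<theta>_cont: "continuous_on UNIV \<theta>"
    unfolding \<theta>_def L_def using Fh
    by (intro continuous_on_divide continuous_on_const
        functional_integral(2)[where K = K and H = "\<lambda>y x. h (- y + x)"] continuous_translate(2)[OF h] F_add F_scale F_bound) auto
  have \<theta>0: "\<theta> 0 = 1" using Fh by (simp add: \<theta>_def L0)
  obtain B where "\<And>x. cmod (\<theta> x) \<le> B" using continuous_bounded[OF \<theta>_cont] by blast
  then have norm\<theta>: "cmod (\<theta> x) = 1" for x using unimodular_homomorphism[of \<theta>, OF hom \<theta>0] by blast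
  \<comment> \<open>The conjugate matches \<open>fourier\<close>, which integrates against
    \<open>cnj (\<xi> x)\<close>.\<close>
  define \<xi> where "\<xi> = (\<lambda>x. cnj (\<theta> x))"
  have \<xi>: "\<xi> \<in> dual_group"
    unfolding dual_group_def \<xi>_def using norm\<theta> hom \<theta>_cont by (auto intro!: continuous_intros)
  have "\<phi> k = fourier \<xi> k" for k
  proof (cases "k \<in> A")
    case True
    note k = A_continuous[OF True]
    \<comment> \<open>\<open>k\<close> has two roles: as an element of A_\<Phi>(G) it is subject to
      multiplicativity of \<open>\<phi>\<close>, and as a continuous function it gives the weights
      with which translates of \<open>h\<close> are superposed under \<open>F\<close>.\<close>
    have "\<phi> k * F h = F (convolution M k h)"
      unfolding F_def convolution_assoc[OF k h M\<Psi>_integrable[OF g], symmetric]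
      using D(4)[OF True in_A[OF h]] by simp
    also have "\<dots> = (\<integral>y. F (\<lambda>x. k y * h (- y + x)) \<partial>M)"
      unfolding convolution_def
      by (rule functional_integral(1)[where K = K, OF continuous_convolution_kernel[OF k h] F_add F_scale F_bound])
    also have "\<dots> = (\<integral>y. k y * F (L y) \<partial>M)"
      using F_scale[OF cL] by (simp add: L_def)
    also have "\<dots> = (\<integral>y. k y * cnj (\<xi> y) * F h \<partial>M)"
      using Fh by (simp add: \<xi>_def \<theta>_def)
    also have "\<dots> = fourier \<xi> k * F h" using True by (simp add: fourier_def)
    finally show ?thesis using Fh by simp
  next
    case False
    then show ?thesis using D(1) by (simp add: extensional_def fourier_def)
  qed
  then show ?thesis using \<xi> by blast
qed

section \<open>Discreteness of the character space and the homeomorphism\<close>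

lemma bij_fourier: "bij_betw fourier dual_group \<Delta>"
  unfolding bij_betw_def using inj_fourier surj_fourier fourier_character by blast

lemma gelfand_topology_discrete: "gelfand_topology A nrmA (convolution M) = discrete_topology \<Delta>"
proof -
  let ?P = "product_topology (\<lambda>_. euclidean) A :: (('g \<Rightarrow> complex) \<Rightarrow> complex) topology"
  have ext: "\<Delta> \<subseteq> topspace ?P"
    using characterD(1) by (auto simp: PiE_def)
  then have "topspace (gelfand_topology A nrmA (convolution M)) = \<Delta>"
    by (auto simp: gelfand_topology_def)
  moreover have "openin (gelfand_topology A nrmA (convolution M)) {\<phi>}" if \<phi>: "\<phi> \<in> \<Delta>" for \<phi>
  proof -
    obtain \<xi> where \<xi>: "\<xi> \<in> dual_group" "\<phi> = fourier \<xi>" using surj_fourier[OF \<phi>] by blast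
    \<comment> \<open>Evaluation at \<open>\<xi>\<close> is a coordinate of the product topology, so
      this condition is open.\<close>
    define W where "W = {\<psi> \<in> topspace ?P. \<psi> \<xi> \<in> - {0}}"
    have "openin ?P W"
      unfolding W_def
      by (rule openin_continuous_map_preimage[OF continuous_map_product_projection[OF dual_group_in_A[OF \<xi>(1)]]])
        (simp add: open_openin[symmetric] open_Compl)
    moreover have "W \<inter> \<Delta> = {\<phi>}"
    proof (intro equalityI subsetI)
      fix \<psi> assume \<psi>: "\<psi> \<in> W \<inter> \<Delta>"
      then obtain \<xi>' where \<xi>': "\<xi>' \<in> dual_group" "\<psi> = fourier \<xi>'" using surj_fourier by blast
      then have "fourier \<xi>' \<xi> \<noteq> 0" using \<psi> by (simp add: W_def)
      then show "\<psi> \<in> {\<phi>}" using fourier_dual_group[OF \<xi>(1) \<xi>'(1)] \<xi> \<xi>' by (auto split: if_splits)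
    next
      fix \<psi> assume "\<psi> \<in> {\<phi>}"
      then show "\<psi> \<in> W \<inter> \<Delta>"
        using \<phi> ext fourier_dual_group[OF \<xi>(1) \<xi>(1)] vol_pos \<xi> by (auto simp: W_def)
    qed
    ultimately show ?thesis unfolding gelfand_topology_def openin_subtopology by metis
  qed
  ultimately show ?thesis by (metis discrete_topology_unique)
qed

end

theorem corollary3p7:
  fixes M :: "'g::{topological_ab_group_add, t2_space} measure"
    and \<Phi> :: "real \<Rightarrow> real"
  assumes "compact (UNIV :: 'g set)"
    and "haar_measure M"
    and "N_function \<Phi>"
  shows "gelfand_topology (A_space M \<Phi>) (A_norm M \<Phi>) (convolution M)
           homeomorphic_space (dual_group_topology :: ('g \<Rightarrow> complex) topology)"
proof -
  interpret orlicz M \<Phi> by unfold_locales (use assms in auto)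
  \<comment> \<open>The bijection is inverted because it runs from the dual group to the character
    space.\<close>
  show ?thesis
    unfolding gelfand_topology_discrete dual_group_topology_discrete
    by (rule discrete_homeomorphic_space[OF bij_betw_the_inv_into[OF bij_fourier]])
qed

end
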